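(* Let $q=3^n$ with $n>1$ and let $m=\frac{q+1}{2}$. Let $\alpha\in\mathbb{F}_{q^2}$ satisfy $\alpha^2+1=0$. Then $\mathrm{Aut}(\mathcal{F}_1)=C_3\rtimes G_1$, where $C_3$ is the cyclic group of order $3$ generated by the automorphism $\gamma$ defined by $\gamma(x)=x+\alpha$ and $\gamma(y)=y$. In particular $|\mathrm{Aut}(\mathcal{F}_1)|=3(q+1)$.
   Context: $\mathcal{F}_1=\mathbb{F}_{q^2}(x,y)$ is the function field over $\mathbb{F}_{q^2}$ defined by $y^m=x(x^2+1)$. $\mathrm{Aut}(\mathcal{F}_1)$ denotes the group of $\overline{\mathbb{F}}_{q^2}$-automorphisms of the constant field extension $\overline{\mathbb{F}}_{q^2}\mathcal{F}_1$. $G_1=\{(x,y)\mapsto(ax,by)\mid a,b\in\mathbb{F}_{q^2},\ a^2=1,\ b^{m}=a\}$, a cyclic subgroup of $\mathrm{Aut}(\mathcal{F}_1)$ of order $q+1$. The semidirect product is internal, with $C_3$ normal. *)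

theory Defs
  imports "HOL-Algebra.Algebra" "HOL-Algebra.Algebraic_Closure_Type" "HOL-Library.Cardinality"
begin

abbreviation type_ring :: "'f::field ring"
  where "type_ring \<equiv> ring_of_type_algebra"

text \<open>The type \<open>'a\<close> is the base field $k$ and \<open>'a alg_closure\<close> its algebraic
  closure $\overline{k}$, which \<open>emb\<close> maps into the field \<open>'f\<close>. The following is the
  subfield $k(x,y)$ of \<open>'f\<close>.\<close>

definition function_field :: "('a::field alg_closure \<Rightarrow> 'f::field) \<Rightarrow> 'f \<Rightarrow> 'f \<Rightarrow> 'f set"
  where "function_field emb x y =
    generate_field type_ring (range (\<lambda>c. emb (to_ac c)) \<union> {x, y})"

text \<open>\<open>'f\<close> is (a copy of) the constant field extension $\overline{k} F$, where $F = k(x,y)$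
  is the function field over $k$ defined by $y^m = x(x^2+1)$. For $m > 0$
  the polynomial $Y^m - x(x^2+1)$ is irreducible over
  $\overline{k}(x)$ (Eisenstein at $x$), so these conditions determine \<open>'f\<close>, \<open>x\<close>, \<open>y\<close> up
  to a $\overline{k}$-isomorphism.\<close>

locale F1_const_ext =
  fixes m :: nat
    and emb :: "'a::field alg_closure \<Rightarrow> 'f::field"
    and x y :: 'f
  assumes emb_hom: "emb \<in> ring_hom type_ring type_ring"
    and x_transcendental:
      "\<And>p :: 'a poly. p \<noteq> 0 \<Longrightarrow> poly (map_poly (\<lambda>c. emb (to_ac c)) p) x \<noteq> 0"
    and curve: "y ^ m = x * (x ^ 2 + 1)"
    and compositum: "generate_field type_ring (range emb \<union> function_field emb x y) = UNIV"

definition Aut_group :: "('a::field alg_closure \<Rightarrow> 'f::field) \<Rightarrow> ('f \<Rightarrow> 'f) monoid"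
  where "Aut_group emb =
    \<lparr>carrier = {\<sigma> \<in> ring_iso type_ring type_ring. \<forall>c. \<sigma> (emb c) = emb c},
     monoid.mult = (\<lambda>\<sigma> \<tau>. \<sigma> \<circ> \<tau>), one = id\<rparr>"

text \<open>Since \<open>x\<close> and \<open>y\<close> generate \<open>'f\<close> over $\overline{k}$, each pair $(a,b)$ belongs to at
  most one automorphism.\<close>

definition G1 :: "nat \<Rightarrow> ('a::field alg_closure \<Rightarrow> 'f::field) \<Rightarrow> 'f \<Rightarrow> 'f \<Rightarrow> ('f \<Rightarrow> 'f) set"
  where "G1 m emb x y =
    {\<sigma> \<in> carrier (Aut_group emb). \<exists>a b :: 'a. a ^ 2 = 1 \<and> b ^ m = a \<and>
       \<sigma> x = emb (to_ac a) * x \<and> \<sigma> y = emb (to_ac b) * y}"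

definition internal_semidirect :: "('g, 'r) monoid_scheme \<Rightarrow> 'g set \<Rightarrow> 'g set \<Rightarrow> bool"
  where "internal_semidirect G N H \<longleftrightarrow>
    group G \<and> N \<lhd> G \<and> subgroup H G \<and> N \<inter> H = {\<one>\<^bsub>G\<^esub>} \<and> N <#>\<^bsub>G\<^esub> H = carrier G"

end

theory Submission
  imports Defs
begin

text \<open>
Let $K$ be the algebraic closure, of characteristic $3$, so that the field is an Artin-Schreier-like
extension of $K(y)$ with basis $1, x, x^2$. The point is that every automorphism $\sigma$ preserves
$K(y)$. As $[K(x,y) : K(z)] = 3$ for $z = \sigma(y)$, there is a
relation between $y$ and $z$ of degree at most $3$ in $y$. Reading it as an equation for
$1/(z-t)$ over $K[y]$, with leading coefficient $h_t(y)$, the element $h_t(y)/(z-t)$ is integral over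
$K[y]$ and has pole order at most $9$ at infinity, hence is $A_t + B_t x$ with $\deg B_t \le 1$.
Over a root of $h_t$ it takes at most two values, so $B_t$ vanishes there. Unless $z \in K(y)$, this
forces $h_t$ to have a single root for all $t$, so that $y^3 \in K(z)$ and then $y \in K(z)$. Thus
$\sigma$ or $\sigma^{-1}$ preserves $K(y)$.

Once $z \in K(y)$, cubing is additive and $\sigma(x)^3 + \sigma(x) = z^m$ gives
$\sigma(x) = \pm x + r$ with $r \in K(y)$. A finite pole of $z$ would be simple and have $m$ divisible
by $3$; so $z$ is linear in $y$, and comparing coefficients leaves only the automorphisms listed.
\<close>

section \<open>Elements of $K[x, y]$ as triples and the pole order at infinity\<close>

hide_const (open) Polynomials.degree UnivPoly.coeff UnivPoly.monom Coset.order

text \<open>Places and valuations are replaced by two elementary devices. The pole order at infinity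
  is the degree of \<open>infty_poly\<close>, and values over a root \<open>c\<close> of a
  polynomial in \<open>y\<close> are taken at the constant points with coordinates
  \<open>\<xi> + \<delta>\<close> and \<open>c\<close>, where \<open>\<delta>\<close> runs through
  \<open>{0, \<alpha>, - \<alpha>}\<close>. The bound 9 is the degree 3 of the relation in
  \<open>y\<close> times the pole order 3 of \<open>y\<close>. It bites because \<open>n > 1\<close>
  gives \<open>m \<ge> 5\<close>: a term in \<open>x^2\<close> would have order at least
  \<open>2m \<ge> 10\<close>, and the coefficient of \<open>x\<close> must be linear. For
  \<open>q = 3\<close> the curve \<open>y^2 = x^3 + x\<close> is elliptic and its translations give
  infinitely many further automorphisms. Only two values occur over a root of \<open>h_t\<close>
  because in the monic relation for \<open>h_t(y)/(z - t)\<close> all coefficients after the first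
  two are divisible by \<open>h_t\<close>. So the roots of \<open>h_t\<close> are roots of the
  linear \<open>B_t\<close>. In characteristic 3 a cubic with a single root has the form
  \<open>d (Y - r)^3 = d Y^3 - d r^3\<close>; hence the two middle coefficients of the relation
  vanish at almost all \<open>t\<close>, and so identically. To know this for
  \<open>\<sigma>\<close> or its inverse is enough, as the listed maps are closed under
  inversion.\<close>

type_synonym 'k triple = "'k poly \<times> 'k poly \<times> 'k poly"

text \<open>A triple \<open>(A, B, C)\<close> stands for $A + Bx + Cx^2$ over $K[y]$; products are reduced with
  $x^3 = y^m - x$, and \<open>monom 1 m\<close> is $y^m$.\<close>

fun tmul :: "nat \<Rightarrow> 'k::field triple \<Rightarrow> 'k triple \<Rightarrow> 'k triple" where
  "tmul m (A, B, C) (A', B', C') =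
     (A * A' + monom 1 m * (B * C' + C * B'),
      A * B' + B * A' - (B * C' + C * B') + monom 1 m * (C * C'),
      A * C' + B * B' + C * A' - C * C')"

text \<open>This is \<open>p(t^3)\<close>, not the cube of \<open>p\<close>: the substitution of
  \<open>t^3\<close> for \<open>y\<close>.\<close>

definition cubed :: "'k::field poly \<Rightarrow> 'k poly" where
  "cubed p = pcompose p (monom 1 3)"

lemma cubed_simps [simp]:
  "cubed 0 = 0" "cubed (p + q) = cubed p + cubed q" "cubed (p - q) = cubed p - cubed q"
  "cubed (p * q) = cubed p * cubed q"
  by (simp_all add: cubed_def pcompose_add pcompose_diff pcompose_mult)

lemma coeff_cubed: "coeff (cubed p) k = (if 3 dvd k then coeff p (k div 3) else 0)"
proof (induction p arbitrary: k)
  case (pCons a p)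
  have 2: "\<not> (3::nat) dvd Suc (Suc 0)" by presburger
  have eq: "cubed (pCons a p) = [:a:] + monom 1 3 * cubed p"
    by (simp add: cubed_def pcompose_pCons)
  show ?case
  proof (cases "k < 3")
    case True
    then have "k = 0 \<or> k = 1 \<or> k = 2" by auto
    then show ?thesis
      by (elim disjE) (simp_all add: 2 eq coeff_monom_mult coeff_pCons numeral_2_eq_2)
  next
    case False
    then obtain j where j: "k = j + 3"
      by (metis add.commute le_Suc_ex not_less)
    have "coeff [:a:] (j + 3) = 0" by (simp add: coeff_eq_0)
    then have "coeff (cubed (pCons a p)) k = coeff (cubed p) j"
      by (simp add: eq coeff_monom_mult j)
    also have "\<dots> = (if 3 dvd k then coeff (pCons a p) (k div 3) else 0)"
      using pCons.IH[of j] by (simp add: j)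
    finally show ?thesis .
  qed
qed simp

lemma cubed_monom: "cubed (monom 1 m) = monom 1 (3 * m)"
proof (rule poly_eqI)
  show "coeff (cubed (monom 1 m)) n = coeff (monom 1 (3 * m)) n" for n
    by (cases "3 dvd n") (auto simp: coeff_cubed)
qed

lemma cubed_eq_0_iff [simp]: "cubed p = 0 \<longleftrightarrow> p = 0"
proof
  assume "cubed p = 0"
  then have "coeff (cubed p) (3 * k) = 0" for k by simp
  then show "p = 0" by (intro poly_eqI) (simp add: coeff_cubed)
qed simp

lemma degree_cubed: "degree (cubed p) = 3 * degree p"
proof -
  have "degree (pcompose p (monom (1::'a) 3)) = degree p * degree (monom (1::'a) 3)"
    by (rule degree_pcompose)
  then show ?thesis by (simp add: cubed_def degree_monom_eq)
qed

lemma degree_mult_monom: "p \<noteq> 0 \<Longrightarrow> degree (p * monom 1 k) = degree p + k"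
  for p :: "'k::field poly"
  by (simp add: degree_mult_eq degree_monom_eq)

text \<open>On the curve, \<open>y\<close> and \<open>x\<close> have poles of order \<open>3\<close> and \<open>m\<close> at the only point at
  infinity. Substituting \<open>t^3\<close> and \<open>t^m\<close> turns the degree in \<open>t\<close> into this pole order: there
  are no cancellations, as \<open>0\<close>, \<open>m\<close>, \<open>2m\<close> are distinct modulo \<open>3\<close>.\<close>

fun infty_poly :: "nat \<Rightarrow> 'k::field triple \<Rightarrow> 'k poly" where
  "infty_poly m (A, B, C) = cubed A + cubed B * monom 1 m + cubed C * monom 1 (2 * m)"

declare infty_poly.simps [simp del]

lemma infty_poly_add:
  "infty_poly m (A + A', B + B', C + C') = infty_poly m (A, B, C) + infty_poly m (A', B', C')"
  by (simp add: infty_poly.simps algebra_simps)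

lemma coeff_mult_monom: "coeff (p * monom 1 k) j = (if k \<le> j then coeff p (j - k) else 0)"
  for p :: "'k::field poly"
  using coeff_monom_mult[of 1 k p j] by (simp add: mult.commute)

lemma coeff_infty_poly:
  assumes m: "m mod 3 = 2"
  shows "coeff (infty_poly m (A, B, C)) (3 * k) = coeff A k"
    and "coeff (infty_poly m (A, B, C)) (m + 3 * k) = coeff B k"
    and "coeff (infty_poly m (A, B, C)) (2 * m + 3 * k) = coeff C k"
proof -
  have 1: "\<not> 3 dvd 3 * k - m" if "m \<le> 3 * k"
    using that m by presburger
  have 2: "\<not> 3 dvd 3 * k - 2 * m" if "2 * m \<le> 3 * k"
    using that m by presburger
  have 3: "\<not> 3 dvd m + 3 * k"
    using m by presburger
  have 4: "\<not> 3 dvd m + 3 * k - 2 * m" if "2 * m \<le> m + 3 * k"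
    using that m by presburger
  have 5: "\<not> 3 dvd 2 * m + 3 * k"
    using m by presburger
  have 6: "\<not> 3 dvd 2 * m + 3 * k - m"
    using m by presburger
  show "coeff (infty_poly m (A, B, C)) (3 * k) = coeff A k"
    using 1 2 by (simp add: infty_poly.simps coeff_mult_monom coeff_cubed)
  show "coeff (infty_poly m (A, B, C)) (m + 3 * k) = coeff B k"
    using 3 4 by (simp add: infty_poly.simps coeff_mult_monom coeff_cubed)
  show "coeff (infty_poly m (A, B, C)) (2 * m + 3 * k) = coeff C k"
    using 5 6 by (simp add: infty_poly.simps coeff_mult_monom coeff_cubed)
qed

lemma infty_poly_eq_0_iff:
  assumes m: "m mod 3 = 2"
  shows "infty_poly m f = 0 \<longleftrightarrow> f = (0, 0, 0)"
proof -
  obtain A B C where f: "f = (A, B, C)" by (cases f) auto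
  have "A = 0 \<and> B = 0 \<and> C = 0" if "infty_poly m (A, B, C) = 0"
    using coeff_infty_poly[OF m, of A B C, symmetric] unfolding that by (simp add: poly_eq_iff)
  moreover have "infty_poly m (0, 0, 0) = 0" by (simp add: infty_poly.simps)
  ultimately show ?thesis unfolding f by blast
qed

lemma degree_infty_poly_ge:
  assumes m: "m mod 3 = 2"
  shows "3 * degree A \<le> degree (infty_poly m (A, B, C))"
    and "B \<noteq> 0 \<Longrightarrow> m + 3 * degree B \<le> degree (infty_poly m (A, B, C))"
    and "C \<noteq> 0 \<Longrightarrow> 2 * m + 3 * degree C \<le> degree (infty_poly m (A, B, C))"
proof -
  show "3 * degree A \<le> degree (infty_poly m (A, B, C))"
  proof (cases "A = 0")
    case False
    then show ?thesis
      by (intro le_degree) (simp only: coeff_infty_poly[OF m], simp)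
  qed simp
  show "m + 3 * degree B \<le> degree (infty_poly m (A, B, C))" if "B \<noteq> 0"
    using that by (intro le_degree) (simp only: coeff_infty_poly[OF m], simp)
  show "2 * m + 3 * degree C \<le> degree (infty_poly m (A, B, C))" if "C \<noteq> 0"
    using that by (intro le_degree) (simp only: coeff_infty_poly[OF m], simp)
qed

text \<open>Absence of cancellation, in the form that controls the correction term in
  \<open>degree_tmul\<close>.\<close>

lemma degree_infty_poly_parts:
  assumes m: "m mod 3 = 2"
  shows "degree (cubed B * monom 1 m) \<le> degree (infty_poly m (A, B, C))"
    and "degree (cubed C * monom 1 (2 * m)) \<le> degree (infty_poly m (A, B, C))"
proof -
  show "degree (cubed B * monom 1 m) \<le> degree (infty_poly m (A, B, C))"
    using degree_infty_poly_ge(2)[OF m, of B A C]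
    by (cases "B = 0") (simp_all add: degree_mult_monom degree_cubed add.commute)
  show "degree (cubed C * monom 1 (2 * m)) \<le> degree (infty_poly m (A, B, C))"
    using degree_infty_poly_ge(3)[OF m, of C A B]
    by (cases "C = 0") (simp_all add: degree_mult_monom degree_cubed add.commute)
qed

text \<open>The pole order is additive although \<open>infty_poly\<close> is not multiplicative:
  \<open>t^m\<close> and \<open>t^3\<close> satisfy \<open>x^3 = y^m\<close> instead of
  \<open>x^3 = y^m - x\<close>. The lower term \<open>- x\<close> causes the correction
  \<open>D\<close>, whose degree lies at least \<open>2m\<close> below that of the product. The
  absence of zero divisors obtained here later takes the place of an irreducibility proof for the
  curve equation.\<close>

lemma degree_tmul:
  assumes m: "m mod 3 = 2" and f: "f \<noteq> (0, 0, 0)" and g: "g \<noteq> (0, 0, 0)"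
  shows "degree (infty_poly m (tmul m f g)) = degree (infty_poly m f) + degree (infty_poly m g)"
    and "tmul m f g \<noteq> (0, 0, 0)"
proof -
  obtain A B C where fe: "f = (A, B, C)" by (cases f) auto
  obtain A' B' C' where ge: "g = (A', B', C')" by (cases g) auto
  let ?F = "infty_poly m f" and ?G = "infty_poly m g" and ?n = "degree (infty_poly m f) + degree (infty_poly m g)"
  define D where "D = cubed (B * C' + C * B') * monom 1 m + cubed (C * C') * monom 1 (2 * m)"
  have M: "monom (1::'a) (3 * m) = monom 1 m * (monom 1 m * monom 1 m)"
    "monom (1::'a) (2 * m) = monom 1 m * monom 1 m"
    by (simp_all add: mult_monom numeral_3_eq_3 mult_2)
  have split: "infty_poly m (tmul m f g) = ?F * ?G - D"
    unfolding fe ge D_def by (simp add: infty_poly.simps cubed_monom M) (simp add: algebra_simps)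
  have nz: "?F \<noteq> 0" "?G \<noteq> 0" using f g infty_poly_eq_0_iff[OF m] by blast+
  then have dFG: "degree (?F * ?G) = ?n" by (simp add: degree_mult_eq)
  \<comment> \<open>After multiplication by \<open>t^(2m)\<close>, each term of \<open>D\<close> is
    a product of one part of \<open>?F\<close> and one part of \<open>?G\<close>, and those are
    bounded separately.\<close>
  have "D * monom 1 (2 * m) =
      (cubed B * monom 1 m) * (cubed C' * monom 1 (2 * m))
    + (cubed C * monom 1 (2 * m)) * (cubed B' * monom 1 m)
    + (cubed C * monom 1 (2 * m)) * (cubed C' * monom 1 (2 * m))"
    unfolding D_def by (simp add: M algebra_simps)
  moreover have "degree ((cubed B * monom 1 m) * (cubed C' * monom 1 (2 * m))) \<le> ?n"
    "degree ((cubed C * monom 1 (2 * m)) * (cubed B' * monom 1 m)) \<le> ?n"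
    "degree ((cubed C * monom 1 (2 * m)) * (cubed C' * monom 1 (2 * m))) \<le> ?n"
    unfolding fe ge
    by (meson add_mono degree_infty_poly_parts[OF m] degree_mult_le order_trans)+
  ultimately have "degree (D * monom 1 (2 * m)) \<le> ?n"
    by (simp add: degree_add_le)
  then have D: "D = 0 \<or> degree D + 2 * m \<le> ?n"
    using degree_mult_monom[of D "2 * m"] by fastforce
  have m0: "m > 0" using m by (cases m) auto
  show deg: "degree (infty_poly m (tmul m f g)) = ?n"
  proof (cases "D = 0")
    case False
    then have "degree (- D) < degree (?F * ?G)" using D m0 dFG by simp
    then show ?thesis
      unfolding split using degree_add_eq_left[of "- D" "?F * ?G"] dFG by simp
  qed (simp add: split dFG)
  have "infty_poly m (tmul m f g) \<noteq> 0"
  proof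
    assume eq: "infty_poly m (tmul m f g) = 0"
    then have "D = ?F * ?G" using split by simp
    then have "D \<noteq> 0" "degree D = ?n" using nz dFG by auto
    then show False using D m0 by simp
  qed
  then show "tmul m f g \<noteq> (0, 0, 0)" using infty_poly_eq_0_iff[OF m] by blast
qed

section \<open>The function field over the closed constants\<close>

lemma alg_closed_split_root:
  fixes p :: "'k::alg_closed_field poly"
  assumes "p \<noteq> 0" "degree p \<noteq> 0"
  obtains r q where "p = [:- r, 1:] * q" "degree p = Suc (degree q)" "q \<noteq> 0"
proof -
  obtain r where "poly p r = 0"
    using alg_closed_imp_poly_has_root[of p] assms by auto
  then obtain q where q: "p = [:- r, 1:] * q"
    by (metis poly_eq_0_iff_dvd dvdE)
  then have "q \<noteq> 0" using assms by auto
  moreover from this have "degree p = Suc (degree q)"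
    unfolding q by (subst degree_mult_eq) auto
  ultimately show ?thesis using q that by blast
qed

text \<open>The adjugate is the product of the two conjugates under $x \mapsto x \pm \alpha$ with
  $\alpha^2 = -1$, and the norm is the product of all three, both simplified modulo $3$.\<close>

fun adjugate :: "nat \<Rightarrow> 'k::field triple \<Rightarrow> 'k triple" where
  "adjugate m (A, B, C) = ((A - C)\<^sup>2 + B\<^sup>2 - monom 1 m * (B * C), monom 1 m * C\<^sup>2 - A * B, B\<^sup>2 + C\<^sup>2 - A * C)"

fun tnorm :: "nat \<Rightarrow> 'k::field triple \<Rightarrow> 'k poly" where
  "tnorm m (A, B, C) = A * (A - C)\<^sup>2 + A * B\<^sup>2 + monom 1 m * (B * C\<^sup>2 + B ^ 3) + (monom 1 m)\<^sup>2 * C ^ 3"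

text \<open>This is the substitution \<open>x \<mapsto> x + a\<close>, reduced with
  \<open>a^2 = -1\<close> and \<open>2 = -1\<close>.\<close>

fun conj_triple :: "'k::field poly \<Rightarrow> 'k triple \<Rightarrow> 'k triple" where
  "conj_triple a (A, B, C) = (A + a * B - C, B - a * C, C)"

lemma tmul_conj_triple:
  fixes a :: "'k::field poly"
  assumes "(3 :: 'k poly) = 0" "a\<^sup>2 = - 1"
  shows "tmul m (conj_triple a f) (conj_triple (- a) f) = adjugate m f"
proof (cases f)
  case (fields A B C)
  define M where "M = monom (1::'k) m"
  have 1: "(A + a * B - C) * (A - a * B - C) + M * ((B - a * C) * C + C * (B + a * C))
     = (A - C)\<^sup>2 + B\<^sup>2 - M * (B * C) - (a\<^sup>2 + 1) * B\<^sup>2 + 3 * (M * B * C)"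
    by (simp add: algebra_simps power2_eq_square power3_eq_cube)
  have 2: "(A + a * B - C) * (B + a * C) + (B - a * C) * (A - a * B - C)
      - ((B - a * C) * C + C * (B + a * C)) + M * (C * C)
     = M * C\<^sup>2 - A * B + 2 * (a\<^sup>2 + 1) * (B * C) + 3 * (A * B - 2 * B * C)"
    by (simp add: algebra_simps power2_eq_square power3_eq_cube)
  have 3: "(A + a * B - C) * C + (B - a * C) * (B + a * C) + C * (A - a * B - C) - C * C
     = B\<^sup>2 + C\<^sup>2 - A * C - (a\<^sup>2 + 1) * C\<^sup>2 + 3 * (A * C - C\<^sup>2)"
    by (simp add: algebra_simps power2_eq_square power3_eq_cube)
  show ?thesis using 1 2 3 by (simp add: fields M_def assms)
qed

lemma tmul_adjugate:
  assumes "(3 :: 'k::field poly) = 0"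
  shows "tmul m f (adjugate m f) = (tnorm m f, 0, 0 :: 'k poly)"
proof (cases f)
  case (fields A B C)
  define M where "M = monom (1::'k) m"
  define P where "P = (A - C)\<^sup>2 + B\<^sup>2 - M * (B * C)"
  define Q where "Q = M * C\<^sup>2 - A * B"
  define R where "R = B\<^sup>2 + C\<^sup>2 - A * C"
  have 1: "A * P + M * (B * R + C * Q)
     = A * (A - C)\<^sup>2 + A * B\<^sup>2 + M * (B * C\<^sup>2 + B ^ 3) + M\<^sup>2 * C ^ 3 - 3 * (A * B * C * M)"
    unfolding P_def Q_def R_def by (simp add: algebra_simps power2_eq_square power3_eq_cube)
  have 2: "A * Q + B * P - (B * R + C * Q) + M * (C * R) = 0"
    unfolding P_def Q_def R_def by (simp add: algebra_simps power2_eq_square power3_eq_cube)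
  have 3: "A * R + B * Q + C * P - C * R = 0"
    unfolding P_def Q_def R_def by (simp add: algebra_simps power2_eq_square power3_eq_cube)
  show ?thesis using 1 2 3 by (simp add: fields M_def P_def Q_def R_def assms)
qed

definition on_curve :: "nat \<Rightarrow> 'f::field \<Rightarrow> 'f \<Rightarrow> bool" where
  "on_curve m u v \<longleftrightarrow> v ^ m = u * (u\<^sup>2 + 1)"

text \<open>As the constants are algebraically closed, \<open>x_notin\<close> amounts to the
  transcendence of \<open>x\<close>. That constants, \<open>x\<close> and \<open>y\<close> generate
  the field is stated as an induction principle, since it is applied by showing that some set is
  closed under the field operations.\<close>

locale curve_field =
  fixes emb :: "'k::alg_closed_field \<Rightarrow> 'f::field" and x y :: 'f and m :: nat and \<alpha> :: 'k
  assumes emb_1 [simp]: "emb 1 = 1"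
    and emb_add [simp]: "emb (a + b) = emb a + emb b"
    and emb_mult [simp]: "emb (a * b) = emb a * emb b"
    and char_3: "(3 :: 'k) = 0"
    and m_mod: "m mod 3 = 2"
    and m_ge: "m \<ge> 5"
    and \<alpha>_sq: "\<alpha>\<^sup>2 + 1 = 0"
    and curve: "on_curve m x y"
    and x_notin: "x \<notin> range emb"
    and generation: "\<And>S. \<lbrakk>range emb \<subseteq> S; x \<in> S; y \<in> S;
      \<And>a b. a \<in> S \<Longrightarrow> b \<in> S \<Longrightarrow> a + b \<in> S; \<And>a b. a \<in> S \<Longrightarrow> b \<in> S \<Longrightarrow> a * b \<in> S;
      \<And>a. a \<in> S \<Longrightarrow> - a \<in> S; \<And>a. a \<in> S \<Longrightarrow> inverse a \<in> S\<rbrakk> \<Longrightarrow> S = UNIV"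
begin

lemma emb_0 [simp]: "emb 0 = 0"
  using emb_add[of 0 0] unfolding add_0_right by (metis add_cancel_left_right)

lemma emb_minus [simp]: "emb (- a) = - emb a"
  using emb_add[of a "- a"] by (simp add: eq_neg_iff_add_eq_0 add.commute)

lemma emb_diff [simp]: "emb (a - b) = emb a - emb b"
  using emb_add[of a "- b"] by simp

lemma emb_power [simp]: "emb (a ^ n) = emb a ^ n"
  by (induction n) simp_all

lemma emb_eq_0_iff [simp]: "emb a = 0 \<longleftrightarrow> a = 0"
proof
  assume "emb a = 0"
  then have "emb (a * inverse a) = 0" by (simp only: emb_mult mult_zero_left)
  then show "a = 0" by (cases "a = 0") auto
qed simp

lemma emb_eq_iff [simp]: "emb a = emb b \<longleftrightarrow> a = b"
  using emb_eq_0_iff[of "a - b"] by (simp del: emb_eq_0_iff) 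

lemma char_3_f: "(3 :: 'f) = 0"
proof -
  have "(3 :: 'f) = emb (1 + 1 + 1)" by (simp only: emb_add emb_1) simp
  also have "(1 + 1 + 1 :: 'k) = 0" using char_3 by simp
  finally show ?thesis by simp
qed

lemma char_3_poly: "(3 :: 'k poly) = 0"
  using char_3 by (metis of_nat_numeral of_nat_poly pCons_0_0)

lemma two_eq: "(2 :: 'k) = - 1" "(2 :: 'f) = - 1"
  using char_3 char_3_f by (simp_all add: eq_neg_iff_add_eq_0)

lemma \<alpha>_nz [simp]: "\<alpha> \<noteq> 0"
  using \<alpha>_sq by auto

lemma \<alpha>_poly_sq: "[:\<alpha>:]\<^sup>2 = - 1"
proof -
  have "\<alpha> * \<alpha> = - 1" using \<alpha>_sq by (simp add: power2_eq_square eq_neg_iff_add_eq_0)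
  then show ?thesis by (simp add: power2_eq_square one_pCons)
qed

lemma cube_add: "(a + b) ^ 3 = a ^ 3 + b ^ 3" for a b :: 'f
proof -
  have "(a + b) ^ 3 = a ^ 3 + b ^ 3 + 3 * (a\<^sup>2 * b + a * b\<^sup>2)"
    by (simp add: algebra_simps power2_eq_square power3_eq_cube)
  then show ?thesis by (simp add: char_3_f)
qed

section \<open>Values of polynomials with constant coefficients\<close>

definition pe :: "'k poly \<Rightarrow> 'f \<Rightarrow> 'f" where
  "pe p v = poly (map_poly emb p) v"

lemma pe_0 [simp]: "pe 0 v = 0"
  by (simp add: pe_def)

lemma pe_pCons [simp]: "pe (pCons a p) v = emb a + v * pe p v"
  by (simp add: pe_def map_poly_pCons)

lemma pe_1 [simp]: "pe 1 v = 1"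
  by (simp add: one_pCons)

lemma pe_add [simp]: "pe (p + q) v = pe p v + pe q v"
proof -
  have "map_poly emb (p + q) = map_poly emb p + map_poly emb q"
    by (rule poly_eqI) (simp add: coeff_map_poly)
  then show ?thesis by (simp add: pe_def)
qed

lemma pe_minus [simp]: "pe (- p) v = - pe p v"
  using pe_add[of p "- p" v] by (simp add: eq_neg_iff_add_eq_0 add.commute)

lemma pe_diff [simp]: "pe (p - q) v = pe p v - pe q v"
  using pe_add[of p "- q" v] by simp

lemma pe_smult [simp]: "pe (smult a p) v = emb a * pe p v"
proof -
  have "map_poly emb (smult a p) = smult (emb a) (map_poly emb p)"
    by (rule poly_eqI) (simp add: coeff_map_poly)
  then show ?thesis by (simp add: pe_def)
qed

lemma pe_mult [simp]: "pe (p * q) v = pe p v * pe q v"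
  by (induction p) (simp_all add: algebra_simps)

lemma pe_power [simp]: "pe (p ^ n) v = pe p v ^ n"
  by (induction n) simp_all

lemma pe_monom [simp]: "pe (monom a n) v = emb a * v ^ n"
  by (simp add: pe_def map_poly_monom poly_monom)

lemma pe_sum: "pe (\<Sum>i\<in>A. f i) v = (\<Sum>i\<in>A. pe (f i) v)"
  by (induction A rule: infinite_finite_induct) simp_all

lemma pe_emb [simp]: "pe p (emb c) = emb (poly p c)"
  by (induction p) simp_all

lemma pe_pcompose [simp]: "pe (pcompose p q) v = pe p (pe q v)"
  by (induction p) (simp_all add: pcompose_pCons)

lemma pe_altdef: "pe p v = (\<Sum>i\<le>degree p. emb (coeff p i) * v ^ i)"
proof -
  have "pe p v = pe (\<Sum>i\<le>degree p. monom (coeff p i) i) v"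
    by (simp add: poly_as_sum_of_monoms)
  then show ?thesis by (simp add: pe_sum)
qed

lemma pe_altdef': "degree p \<le> n \<Longrightarrow> pe p v = (\<Sum>i\<le>n. emb (coeff p i) * v ^ i)"
  unfolding pe_altdef by (rule sum.mono_neutral_left) (auto simp: coeff_eq_0)

text \<open>Split off linear factors one at a time; one of them must vanish at \<open>w\<close>.
  Thus every nonconstant element, in particular \<open>y\<close> and its images under automorphisms,
  is transcendental.\<close>

lemma pe_eq_0D:
  assumes "pe p w = 0" "p \<noteq> 0"
  shows "w \<in> range emb"
  using assms
proof (induction "degree p" arbitrary: p)
  case 0
  then obtain c where "p = [:c:]" by (metis degree_eq_zeroE)
  with 0 show ?case by simp
next
  case (Suc n)
  then obtain r q where q: "p = [:- r, 1:] * q" "degree p = Suc (degree q)" "q \<noteq> 0"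
    using alg_closed_split_root[of p] by (metis Zero_neq_Suc)
  show ?case
  proof (cases "pe q w = 0")
    case True
    then show ?thesis using Suc q by auto
  next
    case False
    then have "w = emb r" using Suc.prems(1) unfolding q by simp
    then show ?thesis by simp
  qed
qed

lemma y_notin: "y \<notin> range emb"
proof
  assume "y \<in> range emb"
  then obtain c where c: "y = emb c" by auto
  have "pe [:- (c ^ m), 1, 0, 1:] x = x * (x\<^sup>2 + 1) - y ^ m"
    by (simp add: c algebra_simps power2_eq_square)
  then have "pe [:- (c ^ m), 1, 0, 1:] x = 0" using curve by (simp add: on_curve_def)
  then show False using pe_eq_0D x_notin by fastforce
qed

lemma pe_y_eq_0_iff [simp]: "pe p y = 0 \<longleftrightarrow> p = 0"
  using pe_eq_0D y_notin by auto

lemma pe_y_eq_iff [simp]: "pe p y = pe q y \<longleftrightarrow> p = q"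
  using pe_y_eq_0_iff[of "p - q"] by (simp del: pe_y_eq_0_iff)

section \<open>Norms, the basis 1, x, x^2 and denominators in K[y]\<close>

fun ev :: "'k triple \<Rightarrow> 'f \<Rightarrow> 'f \<Rightarrow> 'f" where
  "ev (A, B, C) u v = pe A v + pe B v * u + pe C v * u\<^sup>2"

lemma ev_tmul:
  assumes "on_curve m u v"
  shows "ev (tmul m f g) u v = ev f u v * ev g u v"
proof -
  obtain A B C where f: "f = (A, B, C)" by (cases f) auto
  obtain A' B' C' where g: "g = (A', B', C')" by (cases g) auto
  show ?thesis
    using assms unfolding on_curve_def f g
    by (simp add: algebra_simps power2_eq_square)
qed

text \<open>The norm is a product of three conjugates, each nonzero, and triples have no zero
  divisors.\<close>

lemma tnorm_nonzero:
  fixes f :: "'k triple"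
  assumes "f \<noteq> (0, 0, 0)"
  shows "tnorm m f \<noteq> 0"
proof -
  have "conj_triple a f \<noteq> (0, 0, 0)" for a :: "'k poly"
    using assms by (cases f) auto
  then have "adjugate m f \<noteq> (0, 0, 0)"
    using degree_tmul(2)[OF m_mod] tmul_conj_triple[OF char_3_poly \<alpha>_poly_sq] by metis
  then have "tmul m f (adjugate m f) \<noteq> (0, 0, 0)"
    using degree_tmul(2)[OF m_mod assms] by blast
  then show ?thesis by (auto simp: tmul_adjugate[OF char_3_poly])
qed

lemma ev_adjugate:
  assumes "on_curve m u v"
  shows "ev f u v * ev (adjugate m f) u v = pe (tnorm m f) v"
  using ev_tmul[OF assms, of f "adjugate m f"] by (simp add: tmul_adjugate[OF char_3_poly])

text \<open>A vanishing element has vanishing norm, and the norm is a polynomial in the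
  transcendental \<open>y\<close>. This is the linear independence of \<open>1, x, x^2\<close> over
  \<open>K[y]\<close>.\<close>

lemma ev_eq_0D:
  assumes "ev f x y = 0"
  shows "f = (0, 0, 0)"
  using ev_adjugate[OF curve, of f] assms tnorm_nonzero[of f] by auto

lemma ev_eqD:
  assumes "ev f x y = ev g x y"
  shows "f = g"
proof -
  obtain A B C where f: "f = (A, B, C)" by (cases f) auto
  obtain A' B' C' where g: "g = (A', B', C')" by (cases g) auto
  have "ev (A - A', B - B', C - C') x y = 0"
    using assms by (simp add: f g algebra_simps)
  from ev_eq_0D[OF this] show ?thesis by (simp add: f g)
qed

text \<open>The fractions with denominator in \<open>K[y]\<close> already form a field. Only
  inverses need an idea: the norm serves as the new denominator and the adjugate as the
  numerator.\<close>

lemma ev_fraction_exists: "\<exists>f d. d \<noteq> 0 \<and> w * pe d y = ev f x y"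
proof -
  define S where "S = {w. \<exists>f d. d \<noteq> 0 \<and> w * pe d y = ev f x y}"
  have "S = UNIV"
  proof (rule generation)
    have "emb c * pe 1 y = ev ([:c:], 0, 0) x y" for c by simp
    then show "range emb \<subseteq> S" unfolding S_def using one_neq_zero by blast
    have "x * pe 1 y = ev (0, 1, 0) x y" by simp
    then show "x \<in> S" unfolding S_def using one_neq_zero by blast
    have "y * pe 1 y = ev ([:0, 1:], 0, 0) x y" by simp
    then show "y \<in> S" unfolding S_def using one_neq_zero by blast
  next
    fix a b assume "a \<in> S" "b \<in> S"
    then obtain f d g e where fg: "d \<noteq> 0" "a * pe d y = ev f x y" "e \<noteq> 0" "b * pe e y = ev g x y"
      unfolding S_def by blast
    obtain A B C where f: "f = (A, B, C)" by (cases f) auto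
    obtain A' B' C' where g: "g = (A', B', C')" by (cases g) auto
    have a: "d \<noteq> 0" "a * pe d y = ev (A, B, C) x y" and b: "e \<noteq> 0" "b * pe e y = ev (A', B', C') x y"
      using fg f g by auto
    have "(a + b) * pe (d * e) y = (a * pe d y) * pe e y + (b * pe e y) * pe d y"
      by (simp add: algebra_simps)
    also have "\<dots> = ev (A * e + A' * d, B * e + B' * d, C * e + C' * d) x y"
      unfolding a b by (simp add: algebra_simps)
    finally show "a + b \<in> S" unfolding S_def using a b by (metis (mono_tags, lifting) mem_Collect_eq mult_eq_0_iff)
    have "(a * b) * pe (d * e) y = (a * pe d y) * (b * pe e y)"
      by (simp add: algebra_simps)
    also have "\<dots> = ev (tmul m (A, B, C) (A', B', C')) x y"
      unfolding a b by (rule ev_tmul[OF curve, symmetric])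
    finally show "a * b \<in> S" unfolding S_def using a b by (metis (mono_tags, lifting) mem_Collect_eq mult_eq_0_iff)
  next
    fix a assume "a \<in> S"
    then obtain f d where "d \<noteq> 0" "a * pe d y = ev f x y"
      unfolding S_def by blast
    moreover obtain A B C where "f = (A, B, C)" by (cases f) auto
    ultimately have a: "d \<noteq> 0" "a * pe d y = ev (A, B, C) x y" by auto
    then have "- a * pe d y = ev (- A, - B, - C) x y" by simp
    then show "- a \<in> S" unfolding S_def using a by blast
    show "inverse a \<in> S"
    proof (cases "a = 0")
      case True
      then show ?thesis using \<open>a \<in> S\<close> by simp
    next
      case False
      let ?f = "(A, B, C)"
      have nz: "ev ?f x y \<noteq> 0" using a False by (metis mult_eq_0_iff pe_y_eq_0_iff)
      then have "?f \<noteq> (0, 0, 0)" by auto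
      then have "tnorm m ?f \<noteq> 0" by (rule tnorm_nonzero)
      moreover have "inverse a * pe (tnorm m ?f) y = ev (tmul m (d, 0, 0) (adjugate m ?f)) x y"
      proof -
        have "inverse a * pe (tnorm m ?f) y = inverse a * (a * pe d y) * ev (adjugate m ?f) x y"
          using ev_adjugate[OF curve, of ?f] a by (metis mult.assoc)
        also have "\<dots> = pe d y * ev (adjugate m ?f) x y" using False by simp
        also have "\<dots> = ev (tmul m (d, 0, 0) (adjugate m ?f)) x y"
          by (subst ev_tmul[OF curve]) simp
        finally show ?thesis .
      qed
      ultimately show ?thesis unfolding S_def by blast
    qed
  qed
  then show ?thesis unfolding S_def by blast
qed

end

section \<open>Integrality and pole bounds\<close>

context curve_field
begin

text \<open>An identity between such functions at the generic point \<open>(x, y)\<close> holds at all points of the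
  curve, in particular at the constant points \<open>(emb \<xi>, emb c)\<close>.\<close>

definition reg :: "nat \<Rightarrow> ('f \<Rightarrow> 'f \<Rightarrow> 'f) \<Rightarrow> bool" where
  "reg n \<phi> \<longleftrightarrow> (\<exists>f. (\<forall>u v. on_curve m u v \<longrightarrow> \<phi> u v = ev f u v) \<and> degree (infty_poly m f) \<le> n)"

lemma reg_mono: "reg n \<phi> \<Longrightarrow> n \<le> n' \<Longrightarrow> reg n' \<phi>"
  unfolding reg_def by (meson order_trans)

lemma reg_ev: "reg (degree (infty_poly m f)) (ev f)"
  unfolding reg_def by blast

lemma reg_pe: "reg (3 * degree p) (\<lambda>u v. pe p v)"
proof -
  have "infty_poly m (p, 0, 0) = cubed p" by (simp add: infty_poly.simps)
  then have "degree (infty_poly m (p, 0, 0)) \<le> 3 * degree p" by (simp add: degree_cubed)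
  moreover have "pe p v = ev (p, 0, 0) u v" for u v by simp
  ultimately show ?thesis unfolding reg_def by blast
qed

lemma reg_add:
  assumes "reg n \<phi>" "reg n \<psi>"
  shows "reg n (\<lambda>u v. \<phi> u v + \<psi> u v)"
proof -
  obtain f where f: "\<And>u v. on_curve m u v \<Longrightarrow> \<phi> u v = ev f u v" "degree (infty_poly m f) \<le> n"
    using assms(1) unfolding reg_def by blast
  obtain g where g: "\<And>u v. on_curve m u v \<Longrightarrow> \<psi> u v = ev g u v" "degree (infty_poly m g) \<le> n"
    using assms(2) unfolding reg_def by blast
  obtain A B C where fe: "f = (A, B, C)" by (cases f) auto
  obtain A' B' C' where ge: "g = (A', B', C')" by (cases g) auto
  have "\<phi> u v + \<psi> u v = ev (A + A', B + B', C + C') u v" if "on_curve m u v" for u v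
    using f(1)[OF that] g(1)[OF that] by (simp add: fe ge algebra_simps)
  moreover have "degree (infty_poly m (A + A', B + B', C + C')) \<le> n"
    using f(2) g(2) unfolding infty_poly_add fe ge by (rule degree_add_le)
  ultimately show ?thesis unfolding reg_def by blast
qed

lemma reg_mult:
  assumes "reg n \<phi>" "reg k \<psi>"
  shows "reg (n + k) (\<lambda>u v. \<phi> u v * \<psi> u v)"
proof -
  obtain f where f: "\<And>u v. on_curve m u v \<Longrightarrow> \<phi> u v = ev f u v" "degree (infty_poly m f) \<le> n"
    using assms(1) unfolding reg_def by blast
  obtain g where g: "\<And>u v. on_curve m u v \<Longrightarrow> \<psi> u v = ev g u v" "degree (infty_poly m g) \<le> k"
    using assms(2) unfolding reg_def by blast
  have "\<phi> u v * \<psi> u v = ev (tmul m f g) u v" if "on_curve m u v" for u v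
    using f(1)[OF that] g(1)[OF that] ev_tmul[OF that] by simp
  moreover have "degree (infty_poly m (tmul m f g)) \<le> n + k"
  proof (cases "f = (0, 0, 0) \<or> g = (0, 0, 0)")
    case True
    then have "tmul m f g = (0, 0, 0)" by (cases f; cases g) auto
    then have "infty_poly m (tmul m f g) = 0" by (simp add: infty_poly.simps)
    then show ?thesis by simp
  next
    case False
    then show ?thesis using degree_tmul(1)[OF m_mod, of f g] f(2) g(2) by simp
  qed
  ultimately show ?thesis unfolding reg_def by blast
qed

lemma reg_0: "reg n (\<lambda>u v. 0)"
  using reg_mono[OF reg_pe[of 0]] by simp

lemma reg_power:
  assumes "reg n \<phi>"
  shows "reg (k * n) (\<lambda>u v. \<phi> u v ^ k)"
proof (induction k)
  case 0
  show ?case using reg_pe[of 1] by simp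
next
  case (Suc k)
  show ?case using reg_mult[OF assms Suc] by simp
qed

lemma reg_sum:
  assumes "\<And>i. i \<in> A \<Longrightarrow> reg n (\<phi> i)"
  shows "reg n (\<lambda>u v. \<Sum>i\<in>A. \<phi> i u v)"
  using assms by (induction A rule: infinite_finite_induct) (simp_all add: reg_0 reg_add)

lemma reg_eq_0:
  assumes "reg n \<phi>" "\<phi> x y = 0" "on_curve m u v"
  shows "\<phi> u v = 0"
proof -
  obtain f where f: "\<And>u v. on_curve m u v \<Longrightarrow> \<phi> u v = ev f u v"
    using assms(1) unfolding reg_def by blast
  then have "f = (0, 0, 0)" using ev_eq_0D assms(2) curve by simp
  then show ?thesis using f assms(3) by simp
qed

text \<open>\<open>reg\<close> bounds one representing triple; the value at the generic point
  determines the triple, so the bound passes to \<open>f\<close>.\<close>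

lemma reg_degree:
  assumes "reg n \<phi>" "\<phi> x y = ev f x y"
  shows "degree (infty_poly m f) \<le> n"
proof -
  obtain g where g: "\<And>u v. on_curve m u v \<Longrightarrow> \<phi> u v = ev g u v" "degree (infty_poly m g) \<le> n"
    using assms(1) unfolding reg_def by blast
  then have "f = g" using ev_eqD[of f g] assms(2) curve by simp
  then show ?thesis using g by simp
qed

text \<open>\<open>reg_power\<close> only bounds the pole order from above. The comparison in
  \<open>bounded_relation\<close> needs the exact order of the leading power.\<close>

lemma triple_power_exists:
  assumes "f \<noteq> (0, 0, 0)"
  shows "\<exists>g. g \<noteq> (0, 0, 0) \<and> (\<forall>u v. on_curve m u v \<longrightarrow> ev g u v = ev f u v ^ k) \<and>
    degree (infty_poly m g) = k * degree (infty_poly m f)"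
proof (induction k)
  case 0
  have "infty_poly m (1, 0, 0) = cubed (1 :: 'k poly)" by (simp add: infty_poly.simps)
  then have "degree (infty_poly m (1 :: 'k poly, 0, 0)) = 0" by (simp add: degree_cubed)
  moreover have "(1 :: 'k poly, 0 :: 'k poly, 0 :: 'k poly) \<noteq> (0, 0, 0)" by simp
  moreover have "ev (1, 0, 0) u v = ev f u v ^ 0" for u v by simp
  ultimately show ?case by (metis mult_zero_left)
next
  case (Suc k)
  then obtain g where g: "g \<noteq> (0, 0, 0)" "\<And>u v. on_curve m u v \<Longrightarrow> ev g u v = ev f u v ^ k"
    "degree (infty_poly m g) = k * degree (infty_poly m f)" by blast
  have "tmul m f g \<noteq> (0, 0, 0)" "degree (infty_poly m (tmul m f g)) = Suc k * degree (infty_poly m f)"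
    using degree_tmul[OF m_mod assms g(1)] g(3) by auto
  moreover have "ev (tmul m f g) u v = ev f u v ^ Suc k" if "on_curve m u v" for u v
    using ev_tmul[OF that] g(2)[OF that] by simp
  ultimately show ?case by blast
qed

text \<open>In characteristic 3 the polynomial \<open>X^3 + X\<close> is additive with kernel
  \<open>{0, \<alpha>, - \<alpha>}\<close>, so its solutions for a given value form a coset of this
  kernel.\<close>

lemma fibre_points:
  "\<exists>\<xi>. \<forall>\<delta>\<in>{0, \<alpha>, - \<alpha>}. on_curve m (emb (\<xi> + \<delta>)) (emb c)"
proof -
  let ?p = "[:- (c ^ m), 1, 0, 1:]"
  obtain \<xi> where "poly ?p \<xi> = 0"
    using alg_closed_imp_poly_has_root[of ?p] by auto
  then have \<xi>: "c ^ m = \<xi> * (\<xi>\<^sup>2 + 1)"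
    by (simp add: algebra_simps power2_eq_square)
  have "c ^ m = (\<xi> + \<delta>) * ((\<xi> + \<delta>)\<^sup>2 + 1)" if "\<delta> \<in> {0, \<alpha>, - \<alpha>}" for \<delta>
  proof -
    have "\<delta> * (\<delta>\<^sup>2 + 1) = 0" using that \<alpha>_sq by auto
    moreover have "(\<xi> + \<delta>) * ((\<xi> + \<delta>)\<^sup>2 + 1)
        = \<xi> * (\<xi>\<^sup>2 + 1) + \<delta> * (\<delta>\<^sup>2 + 1) + 3 * (\<xi>\<^sup>2 * \<delta> + \<xi> * \<delta>\<^sup>2)"
      by (simp add: algebra_simps power2_eq_square)
    ultimately show ?thesis using \<xi> char_3 by simp
  qed
  then have "on_curve m (emb (\<xi> + \<delta>)) (emb c)" if "\<delta> \<in> {0, \<alpha>, - \<alpha>}" for \<delta>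
    unfolding on_curve_def using that by (metis emb_1 emb_add emb_mult emb_power)
  then show ?thesis by blast
qed

lemma ev_emb: "ev (A, B, C) (emb \<xi>) (emb c) = emb (poly A c + poly B c * \<xi> + poly C c * \<xi>\<^sup>2)"
  by simp

text \<open>The three points are distinct, since \<open>2 = -1\<close> separates
  \<open>\<alpha>\<close> from \<open>- \<alpha>\<close>; a second difference isolates
  \<open>c\<close>.\<close>

lemma quadratic_vanishes:
  assumes "\<And>\<delta>. \<delta> \<in> {0, \<alpha>, - \<alpha>} \<Longrightarrow> a + b * (\<xi> + \<delta>) + c * (\<xi> + \<delta>)\<^sup>2 = 0"
  shows "a = 0" "b = 0" "c = 0"
proof -
  have 1: "a + b * \<xi> + c * \<xi>\<^sup>2 = 0" "a + b * (\<xi> + \<alpha>) + c * (\<xi> + \<alpha>)\<^sup>2 = 0"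
    "a + b * (\<xi> - \<alpha>) + c * (\<xi> - \<alpha>)\<^sup>2 = 0"
    using assms[of 0] assms[of \<alpha>] assms[of "- \<alpha>"] by simp_all
  have "2 * (c * \<alpha>\<^sup>2) = (a + b * (\<xi> + \<alpha>) + c * (\<xi> + \<alpha>)\<^sup>2) + (a + b * (\<xi> - \<alpha>) + c * (\<xi> - \<alpha>)\<^sup>2)
     - 2 * (a + b * \<xi> + c * \<xi>\<^sup>2)"
    by (simp add: algebra_simps power2_eq_square)
  then show c: "c = 0" unfolding 1 two_eq by simp
  have "b * \<alpha> = (a + b * (\<xi> + \<alpha>)) - (a + b * \<xi>)" by (simp add: algebra_simps)
  also have "\<dots> = 0" using 1(1,2) c by simp
  finally show b: "b = 0" by simp
  show "a = 0" using 1(1) b c by simp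
qed

text \<open>The bound is deliberately crude: it serves only to transfer the vanishing of a monic
  relation from the generic point to constant points, where its size is irrelevant.\<close>

lemma reg_monic:
  obtains n where "reg n (\<lambda>u v. ev f u v ^ N + (\<Sum>j<N. pe (s j) v * ev f u v ^ (N - Suc j)))"
proof -
  let ?d = "degree (infty_poly m f)"
  define n where "n = N * ?d + (\<Sum>j<N. 3 * degree (s j) + (N - Suc j) * ?d)"
  have "reg n (\<lambda>u v. \<Sum>j<N. pe (s j) v * ev f u v ^ (N - Suc j))"
  proof (rule reg_sum)
    fix j assume j: "j \<in> {..<N}"
    have "3 * degree (s j) + (N - Suc j) * ?d \<le> n"
      unfolding n_def using member_le_sum[of j "{..<N}" "\<lambda>j. 3 * degree (s j) + (N - Suc j) * ?d"] j
      by simp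
    then show "reg n (\<lambda>u v. pe (s j) v * ev f u v ^ (N - Suc j))"
      using reg_mono[OF reg_mult[OF reg_pe reg_power[OF reg_ev]]] by blast
  qed
  moreover have "reg n (\<lambda>u v. ev f u v ^ N)"
    by (rule reg_mono[OF reg_power[OF reg_ev]]) (simp add: n_def)
  ultimately have "reg n (\<lambda>u v. ev f u v ^ N + (\<Sum>j<N. pe (s j) v * ev f u v ^ (N - Suc j)))"
    by (intro reg_add)
  then show ?thesis by (rule that)
qed

text \<open>The ring \<open>K[x, y]\<close> is integrally closed. Take a denominator
  \<open>e\<close> of least degree. At a root \<open>c\<close> of \<open>e\<close> the numerator is
  nilpotent at all three points over \<open>c\<close>, so its three coefficients vanish at
  \<open>c\<close> and the factor \<open>y - c\<close> cancels, against minimality.\<close>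

lemma integral_imp_polynomial:
  assumes eq: "w ^ N + (\<Sum>j<N. pe (s j) y * w ^ (N - Suc j)) = 0"
  shows "\<exists>f. w = ev f x y"
proof -
  obtain e where e: "e \<noteq> 0 \<and> (\<exists>f. w * pe e y = ev f x y)" and
    least: "\<And>d. d \<noteq> 0 \<and> (\<exists>f. w * pe d y = ev f x y) \<Longrightarrow> degree e \<le> degree d"
    using ex_has_least_nat[of "\<lambda>d. d \<noteq> 0 \<and> (\<exists>f. w * pe d y = ev f x y)" _ degree]
      ev_fraction_exists[of w] by meson
  obtain f where f: "w * pe e y = ev f x y" using e by blast
  obtain A B C where fe: "f = (A, B, C)" by (cases f) auto
  have deg: "degree e = 0"
  proof (rule ccontr)
    assume "degree e \<noteq> 0"
    then obtain c e' where e': "e = [:- c, 1:] * e'" "degree e = Suc (degree e')" "e' \<noteq> 0"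
      using alg_closed_split_root e by metis
    obtain \<xi> where \<xi>: "\<forall>\<delta>\<in>{0, \<alpha>, - \<alpha>}. on_curve m (emb (\<xi> + \<delta>)) (emb c)"
      using fibre_points by blast
    \<comment> \<open>This is the given relation multiplied by \<open>e^N\<close>, rewritten for the
      numerator \<open>w * e\<close>; every coefficient but the leading one becomes divisible by
      \<open>e\<close>.\<close>
    define \<Phi> where "\<Phi> u v = ev f u v ^ N + (\<Sum>j<N. pe (s j * e ^ Suc j) v * ev f u v ^ (N - Suc j))" for u v
    obtain n where "reg n \<Phi>"
      unfolding \<Phi>_def by (rule reg_monic)
    moreover have "\<Phi> x y = 0"
    proof -
      have "\<Phi> x y = (w * pe e y) ^ N + (\<Sum>j<N. pe (s j) y * pe e y ^ Suc j * (w * pe e y) ^ (N - Suc j))"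
        by (simp only: \<Phi>_def f pe_mult pe_power)
      also have "(\<Sum>j<N. pe (s j) y * pe e y ^ Suc j * (w * pe e y) ^ (N - Suc j))
         = (\<Sum>j<N. pe e y ^ N * (pe (s j) y * w ^ (N - Suc j)))"
      proof (rule sum.cong)
        fix j assume "j \<in> {..<N}"
        then have "pe e y ^ N = pe e y ^ Suc j * pe e y ^ (N - Suc j)"
          by (simp only: power_add[symmetric]) simp
        then show "pe (s j) y * pe e y ^ Suc j * (w * pe e y) ^ (N - Suc j)
            = pe e y ^ N * (pe (s j) y * w ^ (N - Suc j))"
          by (simp add: power_mult_distrib mult_ac)
      qed simp
      also have "(w * pe e y) ^ N + \<dots> = pe e y ^ N * (w ^ N + (\<Sum>j<N. pe (s j) y * w ^ (N - Suc j)))"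
        by (simp add: power_mult_distrib sum_distrib_left distrib_left mult_ac)
      finally show ?thesis using eq by simp
    qed
    ultimately have \<Phi>: "\<Phi> u v = 0" if "on_curve m u v" for u v
      using reg_eq_0 that by blast
    have "poly A c + poly B c * (\<xi> + \<delta>) + poly C c * (\<xi> + \<delta>)\<^sup>2 = 0" if "\<delta> \<in> {0, \<alpha>, - \<alpha>}" for \<delta>
    proof -
      have "poly e c = 0" by (simp add: e'(1))
      then have "\<Phi> (emb (\<xi> + \<delta>)) (emb c) = ev f (emb (\<xi> + \<delta>)) (emb c) ^ N"
        unfolding \<Phi>_def pe_emb by simp
      then have "ev f (emb (\<xi> + \<delta>)) (emb c) = 0"
        using \<Phi>[OF \<xi>[rule_format, OF that]] by simp
      then show ?thesis unfolding fe ev_emb by (simp only: emb_eq_0_iff)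
    qed
    from quadratic_vanishes[OF this]
    obtain A' B' C' where "A = [:- c, 1:] * A'" "B = [:- c, 1:] * B'" "C = [:- c, 1:] * C'"
      by (metis poly_eq_0_iff_dvd dvdE)
    then have "ev f x y = pe [:- c, 1:] y * ev (A', B', C') x y"
      unfolding fe by (simp only: ev.simps pe_mult) (simp only: algebra_simps)
    moreover have "w * pe e y = pe [:- c, 1:] y * (w * pe e' y)"
      unfolding e'(1) by (simp only: pe_mult mult_ac)
    moreover have "pe [:- c, 1:] y \<noteq> 0" by (simp only: pe_y_eq_0_iff) simp
    ultimately have "w * pe e' y = ev (A', B', C') x y" using f by (metis mult_left_cancel)
    then have "degree e \<le> degree e'" using least e'(3) by blast
    then show False using e'(2) by simp
  qed
  then obtain k where k: "e = [:k:]" by (metis degree_eq_zeroE)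
  then have "k \<noteq> 0" using e by auto
  then have "emb (inverse k) * emb k = 1" by (metis emb_1 emb_mult left_inverse)
  then have "w = emb (inverse k) * (w * pe e y)" by (simp add: k mult_ac)
  also have "\<dots> = ev (smult (inverse k) A, smult (inverse k) B, smult (inverse k) C) x y"
    unfolding f fe by (simp add: algebra_simps)
  finally show ?thesis by blast
qed

text \<open>The claim describes $h(y)/u$ for the constant coefficient $h$ of a relation for $u$, which is
  the leading coefficient of the reciprocal relation for $1/u$.\<close>

lemma bounded_relation:
  assumes u: "u \<noteq> 0" and deg: "\<And>j. degree (p j) \<le> 3"
    and rel: "(\<Sum>j\<le>N. pe (p j) y * u ^ j) = 0" and p0: "p 0 \<noteq> 0"
  shows "\<exists>A B. pe (p 0) y = u * (pe A y + pe B y * x) \<and> degree B \<le> 1 \<and>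
    (\<forall>c. poly (p 0) c = 0 \<longrightarrow> poly B c = 0)"
proof -
  define h where "h = p 0"
  define w where "w = pe h y / u"
  have hy: "pe h y \<noteq> 0" using p0 h_def by simp
  have w0: "w \<noteq> 0" using u hy by (simp add: w_def)
  have N: "N > 0"
  proof (rule ccontr)
    assume "\<not> N > 0"
    then show False using rel hy h_def by simp
  qed
  \<comment> \<open>Multiply the relation by \<open>h^(N-1) / u^N\<close>: the term with
    \<open>u^(j+1)\<close> turns into \<open>p (j+1) * h^j * w^(N-1-j)\<close>, and the constant
    term \<open>h\<close> into \<open>w^N\<close>.\<close>
  have eq: "w ^ N + (\<Sum>j<N. pe (p (Suc j) * h ^ j) y * w ^ (N - Suc j)) = 0"
  proof -
    have "w ^ N + (\<Sum>j<N. pe (p (Suc j) * h ^ j) y * w ^ (N - Suc j))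
      = pe h y ^ (N - 1) / u ^ N * (\<Sum>j\<le>N. pe (p j) y * u ^ j)"
    proof -
      have "pe h y ^ N = pe h y ^ (N - 1) * pe h y" using N by (metis power_minus_mult)
      then have "w ^ N = pe h y ^ (N - 1) / u ^ N * pe h y"
        by (simp add: w_def power_divide)
      moreover have "pe (p (Suc j) * h ^ j) y * w ^ (N - Suc j)
          = pe h y ^ (N - 1) / u ^ N * (pe (p (Suc j)) y * u ^ Suc j)" if "j < N" for j
      proof -
        have "pe h y ^ (N - 1) = pe h y ^ j * pe h y ^ (N - Suc j)"
          using that by (simp flip: power_add)
        moreover have "u ^ N = u ^ Suc j * u ^ (N - Suc j)"
          using that by (simp only: power_add[symmetric]) simp
        ultimately show ?thesis using u by (simp add: w_def power_divide field_simps)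
      qed
      ultimately show ?thesis
        by (simp add: sum.atMost_shift distrib_left sum_distrib_left h_def)
    qed
    then show ?thesis using rel by simp
  qed
  obtain f where f: "w = ev f x y" using integral_imp_polynomial[OF eq] by blast
  obtain A B C where fe: "f = (A, B, C)" by (cases f) auto
  have f0: "f \<noteq> (0, 0, 0)" using f w0 by auto
  define d where "d = degree (infty_poly m f)"
  \<comment> \<open>If \<open>d > 9\<close>, every lower term has pole order at most
    \<open>9 (j+1) + (N-1-j) d \<le> 9 + (N-1) d\<close>, which is less than the order
    \<open>N d\<close> of \<open>w^N\<close>.\<close>
  have d: "d \<le> 9"
  proof (rule ccontr)
    assume d: "\<not> d \<le> 9"
    have "reg (9 + (N - 1) * d) (\<lambda>u v. \<Sum>j<N. pe (p (Suc j) * h ^ j) v * ev f u v ^ (N - Suc j))"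
    proof (rule reg_sum)
      fix j assume j: "j \<in> {..<N}"
      have "degree (h ^ j) \<le> j * 3"
        using degree_power_le[of h j] deg[of 0] h_def by (metis le_trans mult.commute mult_le_mono2)
      then have "degree (p (Suc j) * h ^ j) \<le> 3 + j * 3"
        using degree_mult_le[of "p (Suc j)" "h ^ j"] deg[of "Suc j"] by linarith
      then have "3 * degree (p (Suc j) * h ^ j) \<le> 9 + j * 9" by linarith
      moreover have "j * 9 \<le> j * d" using d by simp
      moreover have "(N - 1) * d = j * d + (N - Suc j) * d"
        using j by (simp flip: add_mult_distrib)
      ultimately have "3 * degree (p (Suc j) * h ^ j) + (N - Suc j) * d \<le> 9 + (N - 1) * d"
        by linarith
      then show "reg (9 + (N - 1) * d) (\<lambda>u v. pe (p (Suc j) * h ^ j) v * ev f u v ^ (N - Suc j))"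
        using reg_mono[OF reg_mult[OF reg_pe reg_power[OF reg_ev]]] unfolding d_def by blast
    qed
    from reg_mult[OF reg_pe[of "-1"] this]
    have reg: "reg (9 + (N - 1) * d) (\<lambda>u v. - (\<Sum>j<N. pe (p (Suc j) * h ^ j) v * ev f u v ^ (N - Suc j)))"
      by simp
    obtain g where g: "\<And>u v. on_curve m u v \<Longrightarrow> ev g u v = ev f u v ^ N"
      "degree (infty_poly m g) = N * d"
      using triple_power_exists[OF f0] unfolding d_def by blast
    have "- (\<Sum>j<N. pe (p (Suc j) * h ^ j) y * ev f x y ^ (N - Suc j)) = ev g x y"
      using eq unfolding f[symmetric] g(1)[OF curve] by (simp add: add_eq_0_iff2)
    from reg_degree[OF reg this] have "N * d \<le> 9 + (N - 1) * d" using g(2) by simp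
    moreover have "N * d = d + (N - 1) * d" using N by (cases N) auto
    ultimately show False using d by simp
  qed
  \<comment> \<open>A nonzero \<open>C\<close> would need order at least \<open>2m \<ge> 10\<close>;
    for nonzero \<open>B\<close>, the bound \<open>m + 3 deg B \<le> 9\<close> with
    \<open>m \<ge> 5\<close> leaves degree at most 1.\<close>
  have C: "C = 0"
  proof (rule ccontr)
    assume "C \<noteq> 0"
    from degree_infty_poly_ge(3)[OF m_mod this, of A B] show False
      using d m_ge unfolding d_def fe by simp
  qed
  have B: "degree B \<le> 1"
  proof (cases "B = 0")
    case False
    from degree_infty_poly_ge(2)[OF m_mod this, of A C] show ?thesis
      using d m_ge unfolding d_def fe by simp
  qed simp
  have roots: "poly B c = 0" if c: "poly h c = 0" for c
  proof (rule ccontr)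
    assume Bc: "poly B c \<noteq> 0"
    obtain \<xi> where \<xi>: "\<forall>\<delta>\<in>{0, \<alpha>, - \<alpha>}. on_curve m (emb (\<xi> + \<delta>)) (emb c)"
      using fibre_points by blast
    define \<Phi> where "\<Phi> u v = ev f u v ^ N + (\<Sum>j<N. pe (p (Suc j) * h ^ j) v * ev f u v ^ (N - Suc j))" for u v
    obtain n where "reg n \<Phi>"
      unfolding \<Phi>_def by (rule reg_monic)
    moreover have "\<Phi> x y = 0" using eq unfolding \<Phi>_def f[symmetric] .
    ultimately have \<Phi>: "\<Phi> u v = 0" if "on_curve m u v" for u v
      using reg_eq_0 that by blast
    define t where "t \<delta> = poly A c + poly B c * (\<xi> + \<delta>)" for \<delta>
    \<comment> \<open>At a root of \<open>h\<close> only the term \<open>j = 0\<close> of the sum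
      survives, leaving \<open>w^N + p_1(c) w^(N-1) = 0\<close>.\<close>
    have two: "t \<delta> = 0 \<or> t \<delta> = - poly (p 1) c" if "\<delta> \<in> {0, \<alpha>, - \<alpha>}" for \<delta>
    proof -
      have t: "ev f (emb (\<xi> + \<delta>)) (emb c) = emb (t \<delta>)"
        unfolding fe ev_emb C t_def by simp
      obtain k where k: "N = Suc k" using N by (cases N) auto
      have "\<Phi> (emb (\<xi> + \<delta>)) (emb c) = emb (t \<delta>) ^ N + emb (poly (p 1) c) * emb (t \<delta>) ^ (N - 1)"
        unfolding \<Phi>_def t pe_emb k sum.lessThan_Suc_shift using c by (simp add: power_0_left)
      then have "emb (t \<delta> ^ k * (t \<delta> + poly (p 1) c)) = 0"
        using \<Phi>[OF \<xi>[rule_format, OF that]] by (simp add: k algebra_simps)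
      then have "t \<delta> ^ k * (t \<delta> + poly (p 1) c) = 0" by (simp only: emb_eq_0_iff)
      then show ?thesis by (auto simp: eq_neg_iff_add_eq_0)
    qed
    \<comment> \<open>With \<open>B\<close> nonzero at \<open>c\<close>, the three points over
      \<open>c\<close> give three distinct values, one more than \<open>two\<close> permits.\<close>
    have "t \<alpha> \<noteq> t 0" "t (- \<alpha>) \<noteq> t 0" using Bc by (auto simp: t_def)
    moreover have "t \<alpha> \<noteq> t (- \<alpha>)"
    proof -
      have "t \<alpha> - t (- \<alpha>) = poly B c * (2 * \<alpha>)" by (simp add: t_def algebra_simps)
      also have "\<dots> \<noteq> 0" using Bc unfolding two_eq by simp
      finally show ?thesis by auto
    qed
    ultimately show False using two[of 0] two[of \<alpha>] two[of "- \<alpha>"] by auto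
  qed
  have "pe h y = u * w" using u by (simp add: w_def)
  then have "pe (p 0) y = u * (pe A y + pe B y * x)" unfolding f fe C h_def by simp
  then show ?thesis using B roots unfolding h_def by blast
qed

end

section \<open>The subfield $K(y)$ and automorphisms\<close>

text \<open>A nonconstant \<open>p\<close> takes the value 1, at a root of
  \<open>p - 1\<close>.\<close>

lemma alg_closed_poly_eq_0:
  fixes p :: "'k::alg_closed_field poly"
  assumes "\<And>c. poly p c = 0"
  shows "p = 0"
proof (cases "degree p = 0")
  case True
  then obtain k where "p = [:k:]" by (metis degree_eq_zeroE)
  then show ?thesis using assms[of 0] by simp
next
  case False
  have "degree p = degree (p - 1 + 1)" by simp
  also have "\<dots> \<le> degree (p - 1)" using degree_add_le[of "p - 1" "degree (p - 1)" 1] by simp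
  finally have "degree (p - 1) > 0" using False by simp
  then obtain c where "poly (p - 1) c = 0" using alg_closed_imp_poly_has_root by blast
  then show ?thesis using assms[of c] by simp
qed

lemma alg_closed_degree_eq_0:
  fixes p :: "'k::alg_closed_field poly"
  assumes "\<And>c. poly p c \<noteq> 0"
  obtains k where "p = [:k:]" "k \<noteq> 0"
proof -
  have "degree p = 0" using alg_closed_imp_poly_has_root[of p] assms by blast
  then obtain k where "p = [:k:]" by (metis degree_eq_zeroE)
  then show ?thesis using that assms[of 0] by simp
qed

text \<open>The cubic is \<open>d\<close> times the cube of a linear factor, and its middle binomial
  coefficients are multiples of 3.\<close>

lemma cubic_single_root:
  fixes a b c d :: "'k::alg_closed_field"
  assumes char_3: "(3 :: 'k) = 0" and d: "d \<noteq> 0"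
    and single: "\<And>r s. poly [:a, b, c, d:] r = 0 \<Longrightarrow> poly [:a, b, c, d:] s = 0 \<Longrightarrow> r = s"
  shows "b = 0" "c = 0"
proof -
  let ?h = "[:a, b, c, d:]"
  have "degree ?h = 3" "?h \<noteq> 0" using d by simp_all
  then obtain r q where q: "?h = [:- r, 1:] * q" "degree q = 2" "q \<noteq> 0"
    using alg_closed_split_root[of ?h] by (metis Suc_inject numeral_2_eq_2 numeral_3_eq_3 zero_neq_numeral)
  obtain r' q' where q': "q = [:- r', 1:] * q'" "degree q' = 1" "q' \<noteq> 0"
    using alg_closed_split_root[of q] q by (metis Suc_inject numeral_2_eq_2 One_nat_def zero_neq_numeral)
  obtain r'' q'' where q'': "q' = [:- r'', 1:] * q''" "degree q'' = 0"
    using alg_closed_split_root[of q'] q' by (metis Suc_inject One_nat_def zero_neq_one)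
  obtain k where k: "q'' = [:k:]" using q''(2) by (metis degree_eq_zeroE)
  have "poly ?h r = 0" "poly ?h r' = 0" "poly ?h r'' = 0"
    unfolding q(1) q'(1) q''(1) by simp_all
  then have "r' = r" "r'' = r" using single by blast+
  then have "?h = [:- r, 1:] * ([:- r, 1:] * ([:- r, 1:] * [:k:]))"
    using q(1) q'(1) q''(1) k by simp
  then have "b = 3 * (k * r\<^sup>2)" "c = - 3 * (k * r)"
    by (simp_all add: algebra_simps power2_eq_square)
  then show "b = 0" "c = 0" by (simp_all add: char_3)
qed

context curve_field
begin

definition rat :: "'f \<Rightarrow> bool" where
  "rat w \<longleftrightarrow> (\<exists>P S. S \<noteq> 0 \<and> w * pe S y = pe P y)"

lemma ratI: "S \<noteq> 0 \<Longrightarrow> w * pe S y = pe P y \<Longrightarrow> rat w"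
  unfolding rat_def by blast

lemma rat_pe [simp]: "rat (pe p y)"
  by (rule ratI[of 1 _ p]) simp_all

lemma rat_emb [simp]: "rat (emb c)"
  using rat_pe[of "[:c:]"] by simp

lemma rat_y [simp]: "rat y"
  using rat_pe[of "[:0, 1:]"] by simp

lemma rat_0 [simp]: "rat 0" and rat_1 [simp]: "rat 1"
  using rat_emb[of 0] rat_emb[of 1] by simp_all

lemma rat_add [simp]: "rat a \<Longrightarrow> rat b \<Longrightarrow> rat (a + b)"
  and rat_mult [simp]: "rat a \<Longrightarrow> rat b \<Longrightarrow> rat (a * b)"
proof -
  assume "rat a" "rat b"
  then obtain P S P' S' where *: "S \<noteq> 0" "a * pe S y = pe P y" "S' \<noteq> 0" "b * pe S' y = pe P' y"
    unfolding rat_def by blast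
  have "(a + b) * pe (S * S') y = (a * pe S y) * pe S' y + (b * pe S' y) * pe S y"
    by (simp add: algebra_simps)
  also have "\<dots> = pe (P * S' + P' * S) y" by (simp add: *)
  finally show "rat (a + b)" by (rule ratI[rotated]) (simp add: *)
  have "(a * b) * pe (S * S') y = (a * pe S y) * (b * pe S' y)"
    by (simp add: algebra_simps)
  also have "\<dots> = pe (P * P') y" by (simp add: *)
  finally show "rat (a * b)" by (rule ratI[rotated]) (simp add: *)
qed

lemma rat_minus [simp]: "rat a \<Longrightarrow> rat (- a)"
  using rat_mult[OF rat_emb[of "-1"]] by simp

lemma rat_diff [simp]: "rat a \<Longrightarrow> rat b \<Longrightarrow> rat (a - b)"
  using rat_add[of a "- b"] by simp

lemma rat_power [simp]: "rat a \<Longrightarrow> rat (a ^ n)"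
  by (induction n) simp_all

lemma rat_inverse [simp]: "rat a \<Longrightarrow> rat (inverse a)"
proof (cases "a = 0")
  case False
  assume "rat a"
  then obtain P S where *: "S \<noteq> 0" "a * pe S y = pe P y" unfolding rat_def by blast
  then have "P \<noteq> 0" using False by (metis mult_eq_0_iff pe_y_eq_0_iff)
  moreover have "inverse a * pe P y = pe S y" using False by (simp flip: *(2))
  ultimately show ?thesis by (rule ratI)
qed simp

lemma rat_pe_rat [simp]: "rat a \<Longrightarrow> rat (pe p a)"
  by (induction p) simp_all

lemma rat_decomposition: "\<exists>a b c. rat a \<and> rat b \<and> rat c \<and> w = a + b * x + c * x\<^sup>2"
proof -
  obtain f d where d: "d \<noteq> 0" "w * pe d y = ev f x y" using ev_fraction_exists by blast
  obtain A B C where f: "f = (A, B, C)" by (cases f) auto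
  define i where "i = inverse (pe d y)"
  have "w = (w * pe d y) * i" using d(1) by (simp add: i_def)
  also have "\<dots> = pe A y * i + (pe B y * i) * x + (pe C y * i) * x\<^sup>2"
    unfolding d(2) f by (simp add: algebra_simps)
  finally show ?thesis using rat_mult[OF rat_pe rat_inverse[OF rat_pe[of d]]] unfolding i_def by blast
qed

lemma rat_independent:
  assumes "rat a" "rat b" "rat c" "a + b * x + c * x\<^sup>2 = 0"
  shows "a = 0" "b = 0" "c = 0"
proof -
  obtain A d where A: "d \<noteq> 0" "a * pe d y = pe A y" using assms(1) unfolding rat_def by blast
  obtain B e where B: "e \<noteq> 0" "b * pe e y = pe B y" using assms(2) unfolding rat_def by blast
  obtain C g where C: "g \<noteq> 0" "c * pe g y = pe C y" using assms(3) unfolding rat_def by blast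
  have "ev (A * e * g, B * d * g, C * d * e) x y
      = (a * pe d y) * pe e y * pe g y + (b * pe e y) * pe d y * pe g y * x + (c * pe g y) * pe d y * pe e y * x\<^sup>2"
    by (simp add: A B C)
  also have "\<dots> = (a + b * x + c * x\<^sup>2) * (pe d y * pe e y * pe g y)"
    by (simp add: algebra_simps)
  also have "\<dots> = 0" using assms(4) by simp
  finally have "(A * e * g, B * d * g, C * d * e) = (0, 0, 0)" by (rule ev_eq_0D)
  then have "A = 0" "B = 0" "C = 0" using A B C by auto
  then show "a = 0" "b = 0" "c = 0" using A B C by auto
qed

lemma x_not_rat: "\<not> rat x"
  using rat_independent[of "- x" 1 0] by auto

lemma x_cube: "x ^ 3 = y ^ m - x"
  using curve by (simp add: on_curve_def algebra_simps power2_eq_square power3_eq_cube)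

lemma cube_expand:
  "(a + b * x + c * x\<^sup>2) ^ 3
    = (a ^ 3 + b ^ 3 * y ^ m + c ^ 3 * (y ^ m)\<^sup>2) + (c ^ 3 * y ^ m - b ^ 3) * x + c ^ 3 * x\<^sup>2"
proof -
  have "(x\<^sup>2) ^ 3 = (x ^ 3)\<^sup>2" by (simp only: power_mult[symmetric] mult.commute)
  also have "\<dots> = (y ^ m)\<^sup>2 - 2 * (y ^ m * x) + x\<^sup>2"
    unfolding x_cube by (simp add: power2_eq_square algebra_simps)
  also have "\<dots> = (y ^ m)\<^sup>2 + y ^ m * x + x\<^sup>2" unfolding two_eq by simp
  finally have "(a + b * x + c * x\<^sup>2) ^ 3
    = a ^ 3 + b ^ 3 * (y ^ m - x) + c ^ 3 * ((y ^ m)\<^sup>2 + y ^ m * x + x\<^sup>2)"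
    by (simp add: cube_add power_mult_distrib x_cube)
  then show ?thesis by (simp add: algebra_simps)
qed

text \<open>The extension over \<open>K(y)\<close> is separable, so it contains no new cube roots.
  Concretely, the coefficient of \<open>x^2\<close> in the cube is \<open>c^3\<close>, and once
  \<open>c = 0\<close> that of \<open>x\<close> is \<open>- b^3\<close>.\<close>

lemma rat_cube_imp_rat:
  assumes "rat (w ^ 3)"
  shows "rat w"
proof -
  obtain a b c where abc: "rat a" "rat b" "rat c" and w: "w = a + b * x + c * x\<^sup>2"
    using rat_decomposition by blast
  have eq: "(a ^ 3 + b ^ 3 * y ^ m + c ^ 3 * (y ^ m)\<^sup>2 - w ^ 3) + (c ^ 3 * y ^ m - b ^ 3) * x + c ^ 3 * x\<^sup>2 = 0"
    using cube_expand[of a b c] unfolding w[symmetric] by simp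
  have "c ^ 3 * y ^ m - b ^ 3 = 0" "c ^ 3 = 0"
    by (rule rat_independent[OF _ _ _ eq]; simp add: abc assms)+
  then show ?thesis using abc by (simp add: w)
qed

lemma pe_2 [simp]: "pe 2 v = 2"
  by (metis one_add_one pe_1 pe_add)

text \<open>This is the characteristic polynomial of the numerator \<open>w\<close> over
  \<open>K(y)\<close>, with trace \<open>C\<close>, second symmetric function \<open>E\<close> and
  constant term minus the norm.\<close>

lemma cubic_relation:
  "\<exists>r :: nat \<Rightarrow> 'k poly. r 3 \<noteq> 0 \<and> (\<Sum>i\<le>3. pe (r i) y * g ^ i) = 0"
proof -
  obtain f d where d: "d \<noteq> 0" "g * pe d y = ev f x y" using ev_fraction_exists by blast
  obtain A B C where f: "f = (A, B, C)" by (cases f) auto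
  define w where "w = ev f x y"
  define E where "E = B\<^sup>2 + C\<^sup>2 - A * C"
  \<comment> \<open>The product of the other two conjugates of \<open>w\<close> is
    \<open>w^2 - C w + E\<close>; the discrepancy is a multiple of 3.\<close>
  have "ev (adjugate m f) x y = w * w - pe C y * w + pe E y
     - 3 * ((pe A y * pe C y - pe C y ^ 2) * x\<^sup>2 + (pe A y * pe B y - pe B y * pe C y) * x + y ^ m * (pe B y * pe C y))"
    unfolding w_def ev_tmul[OF curve, symmetric] f E_def
    by (simp add: algebra_simps power2_eq_square)
  then have adj: "ev (adjugate m f) x y = w * w - pe C y * w + pe E y"
    by (simp add: char_3_f)
  have "w * (w * w - pe C y * w + pe E y) = pe (tnorm m f) y"
    using ev_adjugate[OF curve, of f] unfolding w_def[symmetric] adj .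
  then have cub: "w ^ 3 - pe C y * w\<^sup>2 + pe E y * w - pe (tnorm m f) y = 0"
    by (simp add: algebra_simps power2_eq_square power3_eq_cube)
  \<comment> \<open>Substituting \<open>w = g * d\<close> spreads powers of \<open>d\<close> over
    the coefficients; the leading one is \<open>d^3\<close>, which is nonzero.\<close>
  define r where "r i = (if i = 0 then - tnorm m f else if i = 1 then E * d
     else if i = 2 then - C * d\<^sup>2 else d ^ 3)" for i :: nat
  have "(\<Sum>i\<le>3. pe (r i) y * g ^ i) = w ^ 3 - pe C y * w\<^sup>2 + pe E y * w - pe (tnorm m f) y"
    unfolding w_def d(2)[symmetric] by (simp add: numeral_3_eq_3 numeral_2_eq_2 r_def algebra_simps)
  then show ?thesis using cub d(1) by (intro exI[of _ r]) (simp add: r_def)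
qed

section \<open>Automorphisms over the constants and the subfield K(y)\<close>

definition is_aut :: "('f \<Rightarrow> 'f) \<Rightarrow> bool" where
  "is_aut \<sigma> \<longleftrightarrow> bij \<sigma> \<and> (\<forall>a b. \<sigma> (a + b) = \<sigma> a + \<sigma> b) \<and> (\<forall>a b. \<sigma> (a * b) = \<sigma> a * \<sigma> b) \<and>
     (\<forall>c. \<sigma> (emb c) = emb c)"

lemma is_aut_inv: assumes "is_aut \<sigma>" shows "is_aut (inv_into UNIV \<sigma>)"
proof -
  have b: "bij \<sigma>" and h: "\<And>a b. \<sigma> (a + b) = \<sigma> a + \<sigma> b" "\<And>a b. \<sigma> (a * b) = \<sigma> a * \<sigma> b"
    "\<And>c. \<sigma> (emb c) = emb c"
    using assms by (auto simp: is_aut_def)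
  have i: "\<sigma> (inv_into UNIV \<sigma> a) = a" "inv_into UNIV \<sigma> (\<sigma> a) = a" for a
    using b by (simp_all add: bij_is_surj surj_f_inv_f bij_is_inj)
  have "inv_into UNIV \<sigma> (a + b) = inv_into UNIV \<sigma> a + inv_into UNIV \<sigma> b" "inv_into UNIV \<sigma> (a * b) = inv_into UNIV \<sigma> a * inv_into UNIV \<sigma> b" "inv_into UNIV \<sigma> (emb c) = emb c" for a b c
    by (metis h i)+
  then show ?thesis using b by (simp add: is_aut_def bij_imp_bij_inv)
qed

lemma is_aut_simps:
  assumes "is_aut \<sigma>"
  shows "\<sigma> (a + b) = \<sigma> a + \<sigma> b" "\<sigma> (a * b) = \<sigma> a * \<sigma> b" "\<sigma> (emb c) = emb c"
    "\<sigma> 0 = 0" "\<sigma> 1 = 1" "\<sigma> (- a) = - \<sigma> a" "\<sigma> (a - b) = \<sigma> a - \<sigma> b" "\<sigma> (a ^ n) = \<sigma> a ^ n"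
    "\<sigma> (pe p a) = pe p (\<sigma> a)" "\<sigma> a = \<sigma> b \<longleftrightarrow> a = b"
    "\<sigma> (inv_into UNIV \<sigma> a) = a" "inv_into UNIV \<sigma> (\<sigma> a) = a"
proof -
  have b: "bij \<sigma>" and h: "\<And>a b. \<sigma> (a + b) = \<sigma> a + \<sigma> b" "\<And>a b. \<sigma> (a * b) = \<sigma> a * \<sigma> b"
    "\<And>c. \<sigma> (emb c) = emb c"
    using assms by (auto simp: is_aut_def)
  show "\<sigma> (a + b) = \<sigma> a + \<sigma> b" "\<sigma> (a * b) = \<sigma> a * \<sigma> b" "\<sigma> (emb c) = emb c" by (rule h)+
  show 0: "\<sigma> 0 = 0" and 1: "\<sigma> 1 = 1" using h(3)[of 0] h(3)[of 1] by simp_all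
  show neg: "\<sigma> (- a) = - \<sigma> a" for a using h(1)[of a "- a"] 0 by (simp add: eq_neg_iff_add_eq_0 add.commute)
  show "\<sigma> (a - b) = \<sigma> a - \<sigma> b" using h(1)[of a "- b"] neg by simp
  show "\<sigma> (a ^ n) = \<sigma> a ^ n" by (induction n) (simp_all add: 1 h)
  show "\<sigma> (pe p a) = pe p (\<sigma> a)" by (induction p) (simp_all add: 0 h)
  show "\<sigma> a = \<sigma> b \<longleftrightarrow> a = b" using b by (simp add: bij_is_inj inj_eq)
  show "\<sigma> (inv_into UNIV \<sigma> a) = a" "inv_into UNIV \<sigma> (\<sigma> a) = a"
    using b by (simp_all add: bij_is_surj surj_f_inv_f bij_is_inj)
qed

lemma aut_sum: "is_aut \<sigma> \<Longrightarrow> \<sigma> (\<Sum>i\<in>A. f i) = (\<Sum>i\<in>A. \<sigma> (f i))"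
  by (induction A rule: infinite_finite_induct) (simp_all add: is_aut_simps)

lemma aut_y_notin:
  assumes "is_aut \<sigma>"
  shows "\<sigma> y \<notin> range emb"
proof
  assume "\<sigma> y \<in> range emb"
  then obtain c where "\<sigma> y = \<sigma> (emb c)" using is_aut_simps(3)[OF assms] by auto
  then show False using y_notin is_aut_simps(10)[OF assms] by auto
qed

text \<open>The relation is found for the preimage \<open>g\<close> of \<open>y\<close> and carried
  over by \<open>\<sigma>\<close>, becoming one for \<open>y\<close> over \<open>K[z]\<close>. The
  same coefficients \<open>r i\<close> thus appear in both relations: what the second one forces
  upon them is read off in the first, as a statement about \<open>g^3\<close>.\<close>

lemma aut_y_rat:
  assumes "is_aut \<sigma>"
  shows "rat (\<sigma> y) \<or> rat (inv_into UNIV \<sigma> y)"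
proof (rule ccontr)
  assume nr: "\<not> (rat (\<sigma> y) \<or> rat (inv_into UNIV \<sigma> y))"
  define z where "z = \<sigma> y"
  define g where "g = inv_into UNIV \<sigma> y"
  obtain r :: "nat \<Rightarrow> 'k poly" where r3: "r 3 \<noteq> 0" and rg: "(\<Sum>i\<le>3. pe (r i) y * g ^ i) = 0"
    using cubic_relation[of g] by blast
  have rz: "(\<Sum>i\<le>3. pe (r i) z * y ^ i) = 0"
  proof -
    have "\<sigma> (\<Sum>i\<le>3. pe (r i) y * g ^ i) = 0" unfolding rg by (simp add: is_aut_simps[OF assms])
    then show ?thesis by (simp add: aut_sum is_aut_simps assms g_def z_def)
  qed
  \<comment> \<open>Excluding the roots of \<open>r 3\<close> makes \<open>h_t\<close> a genuine
    cubic in \<open>y\<close>.\<close>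
  have small: "poly (r 1) t = 0 \<and> poly (r 2) t = 0" if t: "poly (r 3) t \<noteq> 0" for t
  proof -
    \<comment> \<open>Expand the \<open>r i\<close> at \<open>t\<close> in powers of
      \<open>u = z - t\<close> and collect by these powers: \<open>p j\<close> is the coefficient of
      \<open>u^j\<close>, a polynomial of degree at most 3 in \<open>y\<close>, and
      \<open>p 0\<close> is \<open>h_t\<close>.\<close>
    define s where "s i = pcompose (r i) [:t, 1:]" for i
    define u where "u = z - emb t"
    have u: "u \<noteq> 0" using aut_y_notin[OF assms] by (auto simp: u_def z_def)
    have su: "pe (s i) u = pe (r i) z" for i by (simp add: s_def u_def)
    define p where "p j = (\<Sum>i\<le>3. monom (coeff (s i) j) i)" for j
    define N where "N = (\<Sum>i\<le>3. degree (s i))"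
    have "degree (p j) \<le> 3" for j
      unfolding p_def by (intro degree_sum_le) (auto intro: order_trans[OF degree_monom_le])
    moreover have "(\<Sum>j\<le>N. pe (p j) y * u ^ j) = 0"
    proof -
      have "(\<Sum>j\<le>N. pe (p j) y * u ^ j) = (\<Sum>j\<le>N. \<Sum>i\<le>3. emb (coeff (s i) j) * y ^ i * u ^ j)"
        unfolding p_def pe_sum by (simp add: sum_distrib_right)
      also have "\<dots> = (\<Sum>i\<le>3. \<Sum>j\<le>N. emb (coeff (s i) j) * y ^ i * u ^ j)"
        by (rule sum.swap)
      also have "\<dots> = (\<Sum>i\<le>3. pe (s i) u * y ^ i)"
      proof (rule sum.cong)
        fix i :: nat assume "i \<in> {..3}"
        then have "degree (s i) \<le> N" unfolding N_def by (intro member_le_sum) auto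
        then show "(\<Sum>j\<le>N. emb (coeff (s i) j) * y ^ i * u ^ j) = pe (s i) u * y ^ i"
          by (subst pe_altdef') (auto simp: sum_distrib_left mult_ac)
      qed simp
      finally show ?thesis using rz su by simp
    qed
    moreover have p0: "p 0 = [:poly (r 0) t, poly (r 1) t, poly (r 2) t, poly (r 3) t:]"
    proof -
      have "coeff (s i) 0 = poly (r i) t" for i
        by (simp add: s_def poly_0_coeff_0[symmetric] poly_pcompose)
      then have "p 0 = (\<Sum>i\<le>3. monom (poly (r i) t) i)" by (simp add: p_def)
      also have "\<dots> = [:poly (r 0) t, poly (r 1) t, poly (r 2) t, poly (r 3) t:]"
        by (simp add: numeral_3_eq_3 numeral_2_eq_2 monom_Suc monom_0)
      finally show ?thesis .
    qed
    moreover have p0nz: "p 0 \<noteq> 0" using t p0 by simp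
    ultimately obtain A B where AB: "pe (p 0) y = u * (pe A y + pe B y * x)" "degree B \<le> 1"
      "\<And>c. poly (p 0) c = 0 \<Longrightarrow> poly B c = 0"
      using bounded_relation[of u p N] u by blast
    have B: "B \<noteq> 0"
    proof
      assume "B = 0"
      then have "u = pe (p 0) y * inverse (pe A y)"
        using AB(1) p0nz by (cases "A = 0") (simp_all add: field_simps)
      then have "rat u" by simp
      then have "rat (u + emb t)" by (intro rat_add rat_emb)
      then show False using nr by (simp add: u_def z_def)
    qed
    \<comment> \<open>Distinct roots of \<open>p 0\<close> would be distinct roots of the nonzero
      \<open>B\<close>, which has degree at most 1.\<close>
    have single: "a = b" if "poly (p 0) a = 0" "poly (p 0) b = 0" for a b
    proof (rule ccontr)
      assume "a \<noteq> b"
      have "{a, b} \<subseteq> {c. poly B c = 0}" using AB(3) that by auto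
      then have "card {a, b} \<le> card {c. poly B c = 0}" using poly_roots_finite[OF B] by (rule card_mono[rotated])
      also have "\<dots> \<le> degree B" by (rule card_poly_roots_bound[OF B])
      finally show False using \<open>a \<noteq> b\<close> AB(2) by simp
    qed
    show ?thesis using cubic_single_root[OF char_3 t] single unfolding p0 by blast
  qed
  \<comment> \<open>The factor \<open>r 3\<close> absorbs the finitely many excluded values of
    \<open>t\<close>.\<close>
  have "r 1 = 0"
  proof -
    have "poly (r 3 * r 1) t = 0" for t using small[of t] by auto
    then show ?thesis using alg_closed_poly_eq_0 r3 by (metis mult_eq_0_iff)
  qed
  moreover have "r 2 = 0"
  proof -
    have "poly (r 3 * r 2) t = 0" for t using small[of t] by auto
    then show ?thesis using alg_closed_poly_eq_0 r3 by (metis mult_eq_0_iff)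
  qed
  ultimately have "pe (r 0) y + pe (r 3) y * g ^ 3 = 0"
    using rg by (simp add: numeral_3_eq_3 numeral_2_eq_2)
  then have "g ^ 3 = - pe (r 0) y * inverse (pe (r 3) y)"
    using r3 by (simp add: field_simps add_eq_0_iff2)
  then have "rat (g ^ 3)" by simp
  then have "rat g" by (rule rat_cube_imp_rat)
  then show False using nr unfolding g_def by blast
qed

end

section \<open>The shape of an automorphism\<close>

text \<open>This excludes a rational \<open>b = B/E\<close> with \<open>b^3 - b = k y^m\<close>. If
  \<open>b\<close> has a pole at infinity, its order times 3 equals \<open>m\<close>, which is prime
  to 3; otherwise the left side has no pole there.\<close>

lemma artin_schreier_no_solution:
  fixes B E :: "'k::field poly"
  assumes m: "m mod 3 = 2" and E: "E \<noteq> 0" and k: "k \<noteq> 0"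
  shows "B ^ 3 - B * E\<^sup>2 \<noteq> smult k (E ^ 3 * monom 1 m)"
proof
  assume eq: "B ^ 3 - B * E\<^sup>2 = smult k (E ^ 3 * monom 1 m)"
  have R: "degree (smult k (E ^ 3 * monom 1 m)) = 3 * degree E + m"
    using E k by (simp add: degree_mult_monom degree_power_eq)
  show False
  proof (cases "degree B \<le> degree E")
    case True
    have "degree (B ^ 3) \<le> 3 * degree E"
      using degree_power_le[of B 3] True by simp
    moreover have "degree (B * E\<^sup>2) \<le> 3 * degree E"
      using degree_mult_le[of B "E\<^sup>2"] degree_power_le[of E 2] True by simp
    ultimately have "3 * degree E + m \<le> 3 * degree E"
      using degree_diff_le[of "B ^ 3" "3 * degree E" "B * E\<^sup>2"] R eq by simp
    then show False using m by simp
  next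
    case False
    then have B: "B \<noteq> 0" by auto
    have b3: "degree (B ^ 3) = 3 * degree B" using B by (simp add: degree_power_eq)
    have "degree (- (B * E\<^sup>2)) < degree (B ^ 3)"
      using degree_mult_le[of B "E\<^sup>2"] degree_power_le[of E 2] False b3 by simp
    then have "degree (B ^ 3 + - (B * E\<^sup>2)) = 3 * degree B"
      using b3 by (simp only: degree_add_eq_left)
    then have "3 * degree B = 3 * degree E + m" using eq R by simp
    then show False using m by presburger
  qed
qed

lemma order_power_eq:
  fixes p :: "'k::field poly"
  assumes "p \<noteq> 0"
  shows "Polynomial.order c (p ^ n) = n * Polynomial.order c p"
  using assms by (induction n) (simp_all add: order_mult)

text \<open>This is \<open>S^N p(P/S)\<close>, the value of \<open>p\<close> at the fraction
  \<open>P/S\<close> with denominators cleared.\<close>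

definition homogenize :: "nat \<Rightarrow> 'k::field poly \<Rightarrow> 'k poly \<Rightarrow> 'k poly \<Rightarrow> 'k poly" where
  "homogenize N p P S = (\<Sum>i\<le>N. smult (coeff p i) (P ^ i * S ^ (N - i)))"

text \<open>Every summand except the top one keeps a factor \<open>S\<close>.\<close>

lemma homogenize_mod: "S dvd homogenize N p P S - smult (coeff p N) (P ^ N)"
proof -
  have "homogenize N p P S = (\<Sum>i<N. smult (coeff p i) (P ^ i * S ^ (N - i))) + smult (coeff p N) (P ^ N)"
    by (simp add: homogenize_def flip: lessThan_Suc_atMost)
  moreover have "S dvd (\<Sum>i<N. smult (coeff p i) (P ^ i * S ^ (N - i)))"
    by (rule dvd_sum) (auto intro!: dvd_smult dvd_mult dvd_power)
  ultimately show ?thesis by simp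
qed

context curve_field
begin

lemma of_nat_m: "(of_nat m :: 'k) \<noteq> 0"
proof -
  have "of_nat m = of_nat (m mod 3) + 3 * (of_nat (m div 3) :: 'k)"
    by (metis mod_mult_div_eq of_nat_add of_nat_mult of_nat_numeral)
  then have "of_nat m = (2 :: 'k)" using char_3 m_mod by simp
  then show ?thesis unfolding two_eq by simp
qed

text \<open>Lowest terms, expressed by the absence of common roots; a denominator of least degree
  has this property.\<close>

lemma rat_reduced:
  assumes "rat w"
  obtains P S where "S \<noteq> 0" "w * pe S y = pe P y" "\<And>c. poly S c = 0 \<Longrightarrow> poly P c \<noteq> 0"
proof -
  obtain S where S: "S \<noteq> 0 \<and> (\<exists>P. w * pe S y = pe P y)" and
    least: "\<And>d. d \<noteq> 0 \<and> (\<exists>P. w * pe d y = pe P y) \<Longrightarrow> degree S \<le> degree d"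
    using ex_has_least_nat[of "\<lambda>d. d \<noteq> 0 \<and> (\<exists>P. w * pe d y = pe P y)" _ degree] assms
    unfolding rat_def by meson
  obtain P where P: "w * pe S y = pe P y" using S by blast
  have "poly P c \<noteq> 0" if S_root: "poly S c = 0" for c
  proof
    assume "poly P c = 0"
    then obtain P' where P': "P = [:- c, 1:] * P'" unfolding poly_eq_0_iff_dvd by (rule dvdE)
    obtain S' where S': "S = [:- c, 1:] * S'" using S_root unfolding poly_eq_0_iff_dvd by (rule dvdE)
    have "pe [:- c, 1:] y \<noteq> 0" by (simp only: pe_y_eq_0_iff) simp
    moreover have "pe [:- c, 1:] y * (w * pe S' y) = pe [:- c, 1:] y * pe P' y"
      using P unfolding P' S' by (simp only: pe_mult mult_ac)
    ultimately have "w * pe S' y = pe P' y" by (metis mult_left_cancel)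
    moreover have "S' \<noteq> 0" using S S' by auto
    ultimately have "degree S \<le> degree S'" using least by blast
    moreover have "degree S = Suc (degree S')"
      unfolding S' using \<open>S' \<noteq> 0\<close> by (subst degree_mult_eq) auto
    ultimately show False by simp
  qed
  then show ?thesis using that S P by blast
qed

lemma pe_homogenize:
  assumes "z * s = w" "degree p \<le> N"
  shows "(\<Sum>i\<le>N. emb (coeff p i) * (w ^ i * s ^ (N - i))) = pe p z * s ^ N"
proof -
  have "w ^ i * s ^ (N - i) = z ^ i * s ^ N" if "i \<le> N" for i
  proof -
    have "s ^ N = s ^ i * s ^ (N - i)" using that by (simp flip: power_add)
    then show ?thesis using assms(1) by (auto simp: power_mult_distrib)
  qed
  then have "(\<Sum>i\<le>N. emb (coeff p i) * (w ^ i * s ^ (N - i))) = (\<Sum>i\<le>N. emb (coeff p i) * z ^ i * s ^ N)"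
    by (intro sum.cong) (auto simp: mult_ac)
  also have "\<dots> = pe p z * s ^ N"
    by (simp add: pe_altdef'[OF assms(2)] sum_distrib_right)
  finally show ?thesis .
qed

text \<open>Compare coefficients of \<open>1, x, x^2\<close> in the image of
  \<open>x^3 + x = y^m\<close>. The last gives \<open>c^3 + c = 0\<close>, the middle one then
  \<open>b^3 = b\<close> once \<open>c = 0\<close>, and the first is the remaining equation for
  \<open>r = a\<close>.\<close>

lemma aut_x_form:
  assumes "is_aut \<sigma>" "rat (\<sigma> y)"
  obtains \<epsilon> r where "\<epsilon>\<^sup>2 = 1" "rat r" "\<sigma> x = r + emb \<epsilon> * x" "r ^ 3 + r + emb \<epsilon> * y ^ m = \<sigma> y ^ m"
proof -
  note S = is_aut_simps[OF assms(1)]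
  obtain a b c where abc: "rat a" "rat b" "rat c" and w: "\<sigma> x = a + b * x + c * x\<^sup>2"
    using rat_decomposition by blast
  have AS: "\<sigma> x ^ 3 + \<sigma> x = \<sigma> y ^ m"
  proof -
    have "\<sigma> (x ^ 3 + x) = \<sigma> (y ^ m)" by (simp add: x_cube)
    then show ?thesis by (simp add: S)
  qed
  have c3: "\<sigma> x ^ 3 = (a ^ 3 + b ^ 3 * y ^ m + c ^ 3 * (y ^ m)\<^sup>2) + (c ^ 3 * y ^ m - b ^ 3) * x + c ^ 3 * x\<^sup>2"
    unfolding w by (rule cube_expand)
  have eq: "(a ^ 3 + b ^ 3 * y ^ m + c ^ 3 * (y ^ m)\<^sup>2 + a - \<sigma> y ^ m)
      + (c ^ 3 * y ^ m - b ^ 3 + b) * x + (c ^ 3 + c) * x\<^sup>2 = 0"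
  proof -
    have "(a ^ 3 + b ^ 3 * y ^ m + c ^ 3 * (y ^ m)\<^sup>2 + a - \<sigma> y ^ m)
        + (c ^ 3 * y ^ m - b ^ 3 + b) * x + (c ^ 3 + c) * x\<^sup>2
      = (a ^ 3 + b ^ 3 * y ^ m + c ^ 3 * (y ^ m)\<^sup>2 + (c ^ 3 * y ^ m - b ^ 3) * x + c ^ 3 * x\<^sup>2)
        + (a + b * x + c * x\<^sup>2) - \<sigma> y ^ m"
      by (simp add: algebra_simps)
    also have "\<dots> = 0" unfolding c3[symmetric] w[symmetric] using AS by simp
    finally show ?thesis .
  qed
  have e0: "a ^ 3 + b ^ 3 * y ^ m + c ^ 3 * (y ^ m)\<^sup>2 + a - \<sigma> y ^ m = 0"
    and e1: "c ^ 3 * y ^ m - b ^ 3 + b = 0" and e2: "c ^ 3 + c = 0"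
    by (rule rat_independent[OF _ _ _ eq]; simp add: abc assms)+
  \<comment> \<open>A nonzero \<open>c\<close> would be the constant \<open>\<alpha>\<close> or
    \<open>- \<alpha>\<close>, and the middle coefficient would make \<open>b\<close> a rational
    solution of \<open>b^3 - b = k' y^m\<close> with a nonzero constant \<open>k'\<close>.\<close>
  have c: "c = 0"
  proof (rule ccontr)
    assume "c \<noteq> 0"
    have "emb (\<alpha>\<^sup>2 + 1) = 0" by (simp only: \<alpha>_sq emb_0)
    then have \<alpha>: "(emb \<alpha>)\<^sup>2 = - 1" by (simp add: eq_neg_iff_add_eq_0)
    have "c * (c\<^sup>2 + 1) = 0" using e2 by (simp add: algebra_simps power2_eq_square power3_eq_cube)
    then have c2: "c\<^sup>2 = - 1" using \<open>c \<noteq> 0\<close> by (simp add: eq_neg_iff_add_eq_0)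
    then have "c\<^sup>2 = (emb \<alpha>)\<^sup>2" using \<alpha> by simp
    then have "c = emb \<alpha> \<or> c = emb (- \<alpha>)" by (simp add: power2_eq_iff)
    then obtain k where k: "c = emb k" by blast
    then have "k \<noteq> 0" using \<open>c \<noteq> 0\<close> by auto
    have c3: "c ^ 3 = emb (- k)" using e2 k by (simp add: eq_neg_iff_add_eq_0)
    obtain B E where BE: "E \<noteq> 0" "b * pe E y = pe B y" using abc(2) unfolding rat_def by blast
    have "pe (B ^ 3 - B * E\<^sup>2) y = (b ^ 3 - b) * pe E y ^ 3"
      unfolding pe_diff pe_mult pe_power BE(2)[symmetric]
      by (simp add: algebra_simps power2_eq_square power3_eq_cube)
    also have "b ^ 3 - b = emb (- k) * y ^ m" using e1 c3 by (simp add: algebra_simps)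
    also have "\<dots> * pe E y ^ 3 = pe (smult (- k) (E ^ 3 * monom 1 m)) y" by simp
    finally have "B ^ 3 - B * E\<^sup>2 = smult (- k) (E ^ 3 * monom 1 m)" by (simp only: pe_y_eq_iff)
    then show False using artin_schreier_no_solution[OF m_mod BE(1), of "- k" B] \<open>k \<noteq> 0\<close> by simp
  qed
  \<comment> \<open>Otherwise \<open>\<sigma>\<close> would map the whole field into
    \<open>K(y)\<close>, contradicting surjectivity at \<open>x\<close>.\<close>
  have "b \<noteq> 0"
  proof
    assume "b = 0"
    then have sx: "rat (\<sigma> x)" using w c abc by simp
    obtain f d where d: "d \<noteq> 0" "inv_into UNIV \<sigma> x * pe d y = ev f x y" using ev_fraction_exists by blast
    obtain A B C where f: "f = (A, B, C)" by (cases f) auto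
    have "\<sigma> (inv_into UNIV \<sigma> x * pe d y) = \<sigma> (ev f x y)" using d by simp
    then have "x * pe d (\<sigma> y) = pe A (\<sigma> y) + pe B (\<sigma> y) * \<sigma> x + pe C (\<sigma> y) * (\<sigma> x)\<^sup>2"
      unfolding f by (simp add: S)
    moreover have dn: "pe d (\<sigma> y) \<noteq> 0" using pe_eq_0D d(1) aut_y_notin[OF assms(1)] by blast
    ultimately have "x = (pe A (\<sigma> y) + pe B (\<sigma> y) * \<sigma> x + pe C (\<sigma> y) * (\<sigma> x)\<^sup>2) * inverse (pe d (\<sigma> y))"
      by (simp add: field_simps)
    moreover have "rat \<dots>" using sx assms(2) by simp
    ultimately have "rat x" by simp
    then show False using x_not_rat by simp
  qed
  have "b * (b\<^sup>2 - 1) = 0" using e1 c by (simp add: algebra_simps power2_eq_square power3_eq_cube)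
  then have b2: "b\<^sup>2 = 1" using \<open>b \<noteq> 0\<close> by simp
  then have "b = emb 1 \<or> b = emb (- 1)" by (simp add: power2_eq_1_iff)
  then obtain \<epsilon> where \<epsilon>: "b = emb \<epsilon>" "\<epsilon>\<^sup>2 = 1"
    by (metis power2_minus power_one)
  have b3: "b ^ 3 = b" using b2 by (simp add: power2_eq_square power3_eq_cube)
  show ?thesis
    by (rule that[of \<epsilon> a]) (use e0 b3 w c abc \<epsilon> in \<open>auto simp: algebra_simps\<close>)
qed

text \<open>An automorphism mapping \<open>K(y)\<close> into itself maps it onto itself. Expand the
  preimage of \<open>y\<close> in the basis \<open>1, x, x^2\<close> and apply
  \<open>\<sigma>\<close>; as \<open>\<sigma> x\<close> is \<open>r\<close> plus a nonzero constant
  times \<open>x\<close>, the coefficients of \<open>x^2\<close> and then of \<open>x\<close> must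
  vanish. This is what later forces degree 1.\<close>

lemma y_rat_in_aut_y:
  assumes "is_aut \<sigma>" "rat (\<sigma> y)"
  obtains e a where "e \<noteq> 0" "y * pe e (\<sigma> y) = pe a (\<sigma> y)"
proof -
  note S = is_aut_simps[OF assms(1)]
  obtain \<epsilon> r where r: "\<epsilon>\<^sup>2 = 1" "rat r" "\<sigma> x = r + emb \<epsilon> * x"
    using aut_x_form[OF assms] by metis
  have \<epsilon>0: "\<epsilon> \<noteq> 0" using r(1) by auto
  obtain f d where d: "d \<noteq> 0" "inv_into UNIV \<sigma> y * pe d y = ev f x y" using ev_fraction_exists by blast
  obtain A B C where f: "f = (A, B, C)" by (cases f) auto
  let ?A = "pe A (\<sigma> y)" and ?B = "pe B (\<sigma> y)" and ?C = "pe C (\<sigma> y)"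
  have "\<sigma> (inv_into UNIV \<sigma> y * pe d y) = \<sigma> (ev f x y)" using d by simp
  then have eq0: "y * pe d (\<sigma> y) = ?A + ?B * \<sigma> x + ?C * (\<sigma> x)\<^sup>2"
    unfolding f by (simp add: S)
  have sq: "(\<sigma> x)\<^sup>2 = r\<^sup>2 + (2 * r * emb \<epsilon>) * x + (emb \<epsilon>)\<^sup>2 * x\<^sup>2"
    unfolding r(3) by (simp add: algebra_simps power2_eq_square)
  have eq: "(?A + ?B * r + ?C * r\<^sup>2 - y * pe d (\<sigma> y)) + (?B * emb \<epsilon> + ?C * (2 * r * emb \<epsilon>)) * x
      + (?C * (emb \<epsilon>)\<^sup>2) * x\<^sup>2 = 0"
    using eq0 unfolding sq unfolding r(3) by (simp add: algebra_simps)
  have two: "rat 2" using rat_pe[of 2] by simp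
  have "?B * emb \<epsilon> + ?C * (2 * r * emb \<epsilon>) = 0" "?C * (emb \<epsilon>)\<^sup>2 = 0"
    by (rule rat_independent[OF _ _ _ eq]; simp add: assms r two)+
  then have "?C = 0" "?B = 0" using \<epsilon>0 by auto
  then show ?thesis using that[of d A] d(1) eq0 by simp
qed

lemma aut_of_rat:
  assumes "is_aut \<sigma>" "rat (\<sigma> y)"
  shows "\<exists>b \<delta>. (b ^ m)\<^sup>2 = 1 \<and> \<delta> \<in> {0, \<alpha>, - \<alpha>} \<and>
    \<sigma> x = emb (b ^ m) * x + emb \<delta> \<and> \<sigma> y = emb b * y"
proof -
  note S = is_aut_simps[OF assms(1)]
  define z where "z = \<sigma> y"
  obtain \<epsilon> r where \<epsilon>: "\<epsilon>\<^sup>2 = 1" and r: "rat r" "\<sigma> x = r + emb \<epsilon> * x"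
      "r ^ 3 + r + emb \<epsilon> * y ^ m = z ^ m"
    using aut_x_form[OF assms] unfolding z_def by metis
  obtain e a where ea: "e \<noteq> 0" "y * pe e z = pe a z"
    using y_rat_in_aut_y[OF assms] unfolding z_def by metis
  obtain P S where PS: "S \<noteq> 0" "z * pe S y = pe P y" "\<And>c. poly S c = 0 \<Longrightarrow> poly P c \<noteq> 0"
    using rat_reduced[OF assms(2)] unfolding z_def by metis
  obtain A E where AE: "E \<noteq> 0" "r * pe E y = pe A y" "\<And>c. poly E c = 0 \<Longrightarrow> poly A c \<noteq> 0"
    using rat_reduced[OF r(1)] by metis
  \<comment> \<open>\<open>W\<close> is \<open>E^3\<close> times the left side of the equation for
    \<open>r\<close>; it has no root in common with \<open>E\<close>.\<close>
  define W where "W = A ^ 3 + A * E\<^sup>2 + smult \<epsilon> (E ^ 3 * monom 1 m)"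
  have WS: "S ^ m * W = P ^ m * E ^ 3"
  proof -
    have "pe (S ^ m * W) y = pe S y ^ m * ((r ^ 3 + r + emb \<epsilon> * y ^ m) * pe E y ^ 3)"
      unfolding W_def by (simp add: AE(2)[symmetric] algebra_simps power2_eq_square power3_eq_cube)
    also have "\<dots> = pe (P ^ m * E ^ 3) y"
      unfolding r(3) by (simp add: PS(2)[symmetric] power_mult_distrib algebra_simps)
    finally show ?thesis by (simp only: pe_y_eq_iff)
  qed
  have W_root: "poly W c \<noteq> 0" if "poly E c = 0" for c
    using AE(3)[OF that] that by (simp add: W_def)
  have P0: "P \<noteq> 0"
  proof
    assume "P = 0"
    then have "z = emb 0" using PS by (metis emb_0 mult_eq_0_iff pe_0 pe_y_eq_0_iff)
    then show False using aut_y_notin[OF assms(1)] unfolding z_def by blast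
  qed
  have "poly S c \<noteq> 0" for c
  proof
    assume c: "poly S c = 0"
    \<comment> \<open>The pole is simple: clearing denominators in \<open>y e(z) = a(z)\<close> and
      reducing modulo \<open>S\<close> leaves \<open>S dvd P^N * l\<close> with \<open>l\<close>
      linear, and \<open>P\<close> does not vanish at \<open>c\<close>. Taking the larger degree for
      \<open>N\<close> ensures that \<open>l\<close> is not zero.\<close>
    define N where "N = max (degree e) (degree a)"
    define l where "l = [:- coeff a N, coeff e N:]"
    have l0: "l \<noteq> 0"
    proof
      assume "l = 0"
      then have ae: "coeff a N = 0" "coeff e N = 0" by (simp_all add: l_def)
      have "a \<noteq> 0"
      proof
        assume "a = 0"
        then have "y * pe e z = 0" using ea(2) by simp
        moreover have "y \<noteq> 0" using y_notin by (metis emb_0 rangeI)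
        ultimately show False using pe_eq_0D[of e z] ea(1) aut_y_notin[OF assms(1)] unfolding z_def by simp
      qed
      then show False using ae ea(1) unfolding N_def by (metis leading_coeff_0_iff max_def)
    qed
    have "[:0, 1:] * homogenize N e P S = homogenize N a P S"
    proof -
      have h: "pe (homogenize N p P S) y = pe p z * pe S y ^ N" if "degree p \<le> N" for p
        unfolding homogenize_def pe_sum using pe_homogenize[OF PS(2) that] by simp
      have "pe ([:0, 1:] * homogenize N e P S) y = y * pe e z * pe S y ^ N"
        using h[of e] by (simp add: N_def)
      also have "\<dots> = pe (homogenize N a P S) y"
        using h[of a] ea(2) by (simp add: N_def)
      finally show ?thesis by (simp only: pe_y_eq_iff)
    qed
    then have "P ^ N * l = (homogenize N a P S - smult (coeff a N) (P ^ N))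
        - [:0, 1:] * (homogenize N e P S - smult (coeff e N) (P ^ N)) + (P ^ N * l
        + smult (coeff a N) (P ^ N) - [:0, 1:] * smult (coeff e N) (P ^ N))"
      by (simp only: algebra_simps)
    also have "P ^ N * l + smult (coeff a N) (P ^ N) - [:0, 1:] * smult (coeff e N) (P ^ N) = 0"
      by (simp add: l_def)
    finally have "P ^ N * l = (homogenize N a P S - smult (coeff a N) (P ^ N))
        - [:0, 1:] * (homogenize N e P S - smult (coeff e N) (P ^ N)) + 0" .
    moreover have "S dvd (homogenize N a P S - smult (coeff a N) (P ^ N))
        - [:0, 1:] * (homogenize N e P S - smult (coeff e N) (P ^ N)) + 0"
      by (intro dvd_add dvd_diff dvd_mult homogenize_mod dvd_0_right)
    ultimately have "S dvd P ^ N * l" by metis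
    then have "Polynomial.order c S \<le> Polynomial.order c (P ^ N * l)"
      using P0 l0 by (intro dvd_imp_order_le) auto
    also have "\<dots> = Polynomial.order c l"
    proof -
      have "Polynomial.order c (P ^ N) = 0" using PS(3)[OF c] by (intro order_0I) simp
      then show ?thesis using P0 l0 by (subst order_mult) auto
    qed
    also have "\<dots> \<le> 1"
      using order_degree[OF l0, of c] by (rule order_trans) (simp add: l_def)
    finally have "Polynomial.order c S = 1" using c PS(1) order_root[of S c] by auto
    then have oS: "Polynomial.order c (S ^ m) = m"
      using PS(1) by (simp add: order_power_eq)
    have Pc: "Polynomial.order c (P ^ m) = 0" using PS(3)[OF c] by (intro order_0I) simp
    have nz: "P ^ m * E ^ 3 \<noteq> 0" using P0 AE(1) by simp
    \<comment> \<open>Counting zeros at \<open>c\<close> gives \<open>m + ord W = 3 ord E\<close>.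
      As \<open>W\<close> and \<open>E\<close> have no common root, \<open>m\<close> would be
      divisible by 3.\<close>
    then have "Polynomial.order c (S ^ m) + Polynomial.order c W
        = Polynomial.order c (P ^ m) + Polynomial.order c (E ^ 3)"
      by (metis WS order_mult)
    then have "m + Polynomial.order c W = 3 * Polynomial.order c E"
      using Pc oS AE(1) by (simp add: order_power_eq)
    moreover have "Polynomial.order c E = 0 \<or> Polynomial.order c W = 0"
      using W_root[of c] by (cases "poly E c = 0") (simp_all add: order_0I)
    ultimately have "m = 3 * Polynomial.order c E" using m_ge by auto
    then show False using m_mod by presburger
  qed
  then obtain s where s: "S = [:s:]" "s \<noteq> 0" by (rule alg_closed_degree_eq_0)
  have "poly E c \<noteq> 0" for c
  proof
    assume c: "poly E c = 0"
    have "poly (S ^ m * W) c = 0" unfolding WS using c by simp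
    then show False using W_root[OF c] s by simp
  qed
  then obtain k where k: "E = [:k:]" "k \<noteq> 0" by (rule alg_closed_degree_eq_0)
  define Z where "Z = smult (inverse s) P"
  define R where "R = smult (inverse k) A"
  have zZ: "z = pe Z y" 
  proof -
    have "emb (inverse s) * emb s = 1" using s by (metis emb_1 emb_mult left_inverse)
    then have "z = emb (inverse s) * (z * pe S y)" by (simp add: s mult_ac)
    then show ?thesis unfolding PS(2) Z_def by simp
  qed
  have rR: "r = pe R y"
  proof -
    have "emb (inverse k) * emb k = 1" using k by (metis emb_1 emb_mult left_inverse)
    then have "r = emb (inverse k) * (r * pe E y)" by (simp add: k mult_ac)
    then show ?thesis unfolding AE(2) R_def by simp
  qed
  \<comment> \<open>Now \<open>y e(Z) = a(Z)\<close> holds between polynomials, and comparing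
    degrees makes the degree of \<open>Z\<close> divide 1.\<close>
  have comp: "[:0, 1:] * pcompose e Z = pcompose a Z"
  proof -
    have "pe ([:0, 1:] * pcompose e Z) y = pe (pcompose a Z) y"
      using ea(2) unfolding zZ by simp
    then show ?thesis by (simp only: pe_y_eq_iff)
  qed
  have "pcompose e Z \<noteq> 0"
  proof
    assume "pcompose e Z = 0"
    then have "pe e z = 0" unfolding zZ by (metis pe_0 pe_pcompose)
    then show False using pe_eq_0D ea(1) aut_y_notin[OF assms(1)] unfolding z_def by blast
  qed
  then have "degree ([:0, 1:] * pcompose e Z) = Suc (degree e * degree Z)"
    by (subst degree_mult_eq) (auto simp: degree_pcompose)
  then have "Suc (degree e * degree Z) = degree a * degree Z"
    unfolding comp by (simp add: degree_pcompose)
  then have "degree Z dvd 1" by (metis dvd_add_right_iff dvd_triv_right plus_1_eq_Suc add.commute)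
  then have dZ: "degree Z = 1" by simp
  obtain b0 b where b: "Z = [:b0, b:]" "b \<noteq> 0"
    by (rule degree1_coeffs[OF dZ])
  define T where "T = R ^ 3 + R"
  have T: "T = Z ^ m - smult \<epsilon> (monom 1 m)"
  proof -
    have "pe (T + smult \<epsilon> (monom 1 m)) y = pe (Z ^ m) y"
      using r(3) unfolding T_def rR zZ by simp
    then have "T + smult \<epsilon> (monom 1 m) = Z ^ m" by (simp only: pe_y_eq_iff)
    then show ?thesis by (simp add: algebra_simps)
  qed
  have dT: "degree T = 3 * degree R"
  proof (cases "degree R = 0")
    case True
    then show ?thesis unfolding T_def
      using degree_add_le[of "R ^ 3" 0 R] degree_power_le[of R 3] by simp
  next
    case False
    then have "R \<noteq> 0" by auto
    then have "degree (R ^ 3) = 3 * degree R" by (simp add: degree_power_eq)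
    then show ?thesis unfolding T_def using False by (simp add: degree_add_eq_left)
  qed
  have cT: "coeff T i = of_nat (m choose i) * b ^ i * b0 ^ (m - i) - (if i = m then \<epsilon> else 0)" if "i \<le> m" for i
    unfolding T b(1) using coeff_linear_poly_power[OF that, of b0 b] by simp
  have "degree T \<le> m"
    unfolding T using degree_power_le[of Z m] dZ
    by (intro degree_diff_le) (simp_all add: degree_monom_le order_trans[OF degree_smult_le])
  \<comment> \<open>The degree of \<open>T\<close> is a multiple of 3 and at most \<open>m\<close>,
    which is 2 modulo 3. So the coefficients at both \<open>m\<close> and \<open>m - 1\<close>
    vanish, giving \<open>b^m = \<epsilon>\<close> and \<open>m b^(m-1) b0 = 0\<close>.\<close>
  then have lt: "degree T < m - 1"
    using m_mod m_ge unfolding dT by presburger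
  have "b0 = 0"
  proof -
    have "0 = coeff T (m - 1)" using lt by (simp add: coeff_eq_0)
    also have "\<dots> = of_nat (m choose (m - 1)) * b ^ (m - 1) * b0 ^ (m - (m - 1))"
      using m_ge by (subst cT) auto
    also have "m choose (m - 1) = m" using m_ge by (subst binomial_symmetric) auto
    also have "m - (m - 1) = 1" using m_ge by simp
    finally show ?thesis using of_nat_m b(2) by simp
  qed
  have "b ^ m = \<epsilon>"
  proof -
    have "0 = coeff T m" using lt by (simp add: coeff_eq_0)
    also have "\<dots> = b ^ m - \<epsilon>" by (subst cT) auto
    finally show ?thesis by simp
  qed
  have "Z = monom b 1" using b \<open>b0 = 0\<close> by (simp add: monom_altdef)
  then have "Z ^ m = smult \<epsilon> (monom 1 m)"
    using \<open>b ^ m = \<epsilon>\<close> by (simp add: monom_power smult_monom)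
  then have "T = 0" using T by simp
  then have "R * ((R - [:\<alpha>:]) * (R + [:\<alpha>:])) = 0"
  proof -
    have "R * ((R - [:\<alpha>:]) * (R + [:\<alpha>:])) = R ^ 3 - R * [:\<alpha>:]\<^sup>2"
      by (simp only: algebra_simps power2_eq_square power3_eq_cube)
    also have "\<dots> = T" unfolding \<alpha>_poly_sq T_def by simp
    finally show ?thesis using \<open>T = 0\<close> by simp
  qed
  moreover have "R = [:- \<alpha>:]" if "R + [:\<alpha>:] = 0"
    using that unfolding eq_neg_iff_add_eq_0[symmetric] by simp
  ultimately have "R = [:0:] \<or> R = [:\<alpha>:] \<or> R = [:- \<alpha>:]"
    by auto
  then obtain \<delta> where \<delta>: "R = [:\<delta>:]" "\<delta> \<in> {0, \<alpha>, - \<alpha>}" by blast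
  have "\<sigma> y = emb b * y" using zZ b \<open>b0 = 0\<close> by (simp add: z_def mult.commute)
  moreover have "\<sigma> x = emb (b ^ m) * x + emb \<delta>"
    using r(2) rR \<delta>(1) \<open>b ^ m = \<epsilon>\<close> by (simp add: add.commute)
  ultimately show ?thesis using \<epsilon> \<open>b ^ m = \<epsilon>\<close> \<delta>(2) by blast
qed

text \<open>If only the inverse preserves \<open>K(y)\<close>, its explicit form is solved for
  \<open>\<sigma> x\<close> and \<open>\<sigma> y\<close>: \<open>b\<close> becomes
  \<open>inverse b\<close>, with the same sign \<open>b^m\<close>, and \<open>\<delta>\<close>
  becomes \<open>- b^m \<delta>\<close>.\<close>

lemma aut_form:
  assumes "is_aut \<sigma>"
  obtains b \<delta> where "(b ^ m)\<^sup>2 = 1" "\<delta> \<in> {0, \<alpha>, - \<alpha>}"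
    "\<sigma> x = emb (b ^ m) * x + emb \<delta>" "\<sigma> y = emb b * y"
proof (cases "rat (\<sigma> y)")
  case True
  then show ?thesis using aut_of_rat[OF assms] that by blast
next
  case False
  let ?\<tau> = "inv_into UNIV \<sigma>"
  note S = is_aut_simps[OF assms]
  have "rat (?\<tau> y)" using aut_y_rat[OF assms] False by blast
  then obtain b \<delta> where b: "(b ^ m)\<^sup>2 = 1" "\<delta> \<in> {0, \<alpha>, - \<alpha>}"
    "?\<tau> x = emb (b ^ m) * x + emb \<delta>" "?\<tau> y = emb b * y"
    using aut_of_rat[OF is_aut_inv[OF assms]] by blast
  have b0: "b \<noteq> 0" using b(1) m_ge by (cases "b = 0") (auto simp: power_0_left)
  have bb: "b ^ m * b ^ m = 1" using b(1) by (simp add: power2_eq_square)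
  have inv: "inverse b ^ m = b ^ m" using bb b0 by (simp add: power_inverse inverse_unique)
  have "y = emb b * \<sigma> y" using arg_cong[OF b(4), of \<sigma>] by (simp add: S)
  then have "emb (inverse b) * y = emb (inverse b * b) * \<sigma> y" by (simp add: mult_ac)
  then have sy: "\<sigma> y = emb (inverse b) * y" using b0 by simp
  have "x = emb (b ^ m) * \<sigma> x + emb \<delta>" using arg_cong[OF b(3), of \<sigma>] by (simp add: S)
  then have "x - emb \<delta> = emb (b ^ m) * \<sigma> x" by (simp add: algebra_simps)
  then have "emb (b ^ m) * (x - emb \<delta>) = emb (b ^ m * b ^ m) * \<sigma> x" by simp
  then have sx: "\<sigma> x = emb (b ^ m) * x + emb (- (b ^ m * \<delta>))" unfolding bb by (simp add: algebra_simps)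
  have "b ^ m = 1 \<or> b ^ m = - 1" using b(1) by (simp add: power2_eq_1_iff)
  then have "- (b ^ m * \<delta>) \<in> {0, \<alpha>, - \<alpha>}" using b(2) by auto
  then show ?thesis using that[of "inverse b" "- (b ^ m * \<delta>)"] sx sy inv b(1) by simp
qed

end

section \<open>Existence of automorphisms and roots of unity\<close>

context curve_field
begin

text \<open>Substitute \<open>(u, v)\<close> for \<open>(x, y)\<close> in a fraction with
  denominator in \<open>K[y]\<close>. Denominators stay nonzero since \<open>v\<close> is
  transcendental, and two representations of one element agree after cross multiplication because
  triples are determined by their value at \<open>(x, y)\<close>.\<close>

lemma hom_exists:
  assumes uv: "on_curve m u v" and v: "v \<notin> range emb"
  obtains \<sigma> where "\<And>a b. \<sigma> (a + b) = \<sigma> a + \<sigma> b" "\<And>a b. \<sigma> (a * b) = \<sigma> a * \<sigma> b"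
    "\<And>c. \<sigma> (emb c) = emb c" "\<sigma> x = u" "\<sigma> y = v"
proof -
  have nz: "pe d v \<noteq> 0" if "d \<noteq> 0" for d using pe_eq_0D that v by blast
  define \<sigma> where "\<sigma> w = (SOME s. \<exists>f d. d \<noteq> 0 \<and> w * pe d y = ev f x y \<and> s * pe d v = ev f u v)" for w
  have \<sigma>: "\<sigma> w * pe d v = ev f u v" if d: "d \<noteq> 0" "w * pe d y = ev f x y" for w d f
  proof -
    have "\<exists>s. \<exists>f d. d \<noteq> 0 \<and> w * pe d y = ev f x y \<and> s * pe d v = ev f u v"
      using d nz by (intro exI[of _ "ev f u v / pe d v"] exI[of _ f] exI[of _ d]) simp
    then have "\<exists>f d. d \<noteq> 0 \<and> w * pe d y = ev f x y \<and> \<sigma> w * pe d v = ev f u v"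
      unfolding \<sigma>_def by (rule someI_ex)
    then obtain g e where e: "e \<noteq> 0" "w * pe e y = ev g x y" "\<sigma> w * pe e v = ev g u v"
      by blast
    have "ev (tmul m f (e, 0, 0)) x y = ev (tmul m g (d, 0, 0)) x y"
      unfolding ev_tmul[OF curve] d(2)[symmetric] e(2)[symmetric] by (simp add: mult_ac)
    then have "ev (tmul m f (e, 0, 0)) u v = ev (tmul m g (d, 0, 0)) u v"
      using ev_eqD by metis
    then have "ev f u v * pe e v = \<sigma> w * pe d v * pe e v"
      unfolding ev_tmul[OF uv] e(3)[symmetric] by (simp add: mult_ac)
    then show ?thesis using nz[OF e(1)] by simp
  qed
  have \<sigma>I: "\<sigma> w = s" if "d \<noteq> 0" "w * pe d y = ev f x y" "s * pe d v = ev f u v" for w s d f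
    using \<sigma>[OF that(1,2)] that(3) nz[OF that(1)] by (metis mult_right_cancel)
  show ?thesis
  proof (rule that)
    show "\<sigma> (emb c) = emb c" for c by (rule \<sigma>I[of 1 _ "([:c:], 0, 0)"]) simp_all
    show "\<sigma> x = u" by (rule \<sigma>I[of 1 _ "(0, 1, 0)"]) simp_all
    show "\<sigma> y = v" by (rule \<sigma>I[of 1 _ "([:0, 1:], 0, 0)"]) simp_all
    fix a b
    obtain f d where f: "d \<noteq> 0" "a * pe d y = ev f x y" using ev_fraction_exists by blast
    obtain g e where g: "e \<noteq> 0" "b * pe e y = ev g x y" using ev_fraction_exists by blast
    obtain A B C where fe: "f = (A, B, C)" by (cases f) auto
    obtain A' B' C' where ge: "g = (A', B', C')" by (cases g) auto
    have de: "d * e \<noteq> 0" using f g by simp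
    have ev_sum: "ev (A * e + A' * d, B * e + B' * d, C * e + C' * d) s t = ev f s t * pe e t + ev g s t * pe d t" for s t
      by (simp add: fe ge algebra_simps)
    have "(a + b) * pe (d * e) y = (a * pe d y) * pe e y + (b * pe e y) * pe d y"
      by (simp add: algebra_simps)
    then have 1: "(a + b) * pe (d * e) y = ev (A * e + A' * d, B * e + B' * d, C * e + C' * d) x y"
      unfolding ev_sum f g .
    have "(\<sigma> a + \<sigma> b) * pe (d * e) v = (\<sigma> a * pe d v) * pe e v + (\<sigma> b * pe e v) * pe d v"
      by (simp add: algebra_simps)
    then have 2: "(\<sigma> a + \<sigma> b) * pe (d * e) v = ev (A * e + A' * d, B * e + B' * d, C * e + C' * d) u v"
      unfolding ev_sum \<sigma>[OF f] \<sigma>[OF g] .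
    show "\<sigma> (a + b) = \<sigma> a + \<sigma> b" by (rule \<sigma>I[OF de 1 2])
    have "(a * b) * pe (d * e) y = (a * pe d y) * (b * pe e y)"
      by (simp add: algebra_simps)
    then have 3: "(a * b) * pe (d * e) y = ev (tmul m f g) x y"
      unfolding ev_tmul[OF curve] f g .
    have "(\<sigma> a * \<sigma> b) * pe (d * e) v = (\<sigma> a * pe d v) * (\<sigma> b * pe e v)"
      by (simp add: algebra_simps)
    then have 4: "(\<sigma> a * \<sigma> b) * pe (d * e) v = ev (tmul m f g) u v"
      unfolding ev_tmul[OF uv] \<sigma>[OF f] \<sigma>[OF g] .
    show "\<sigma> (a * b) = \<sigma> a * \<sigma> b" by (rule \<sigma>I[OF de 3 4])
  qed
qed

text \<open>The new point is on the curve since cubing is additive,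
  \<open>\<epsilon>^3 = \<epsilon>\<close> and \<open>\<delta>^3 + \<delta> = 0\<close>.
  Surjectivity holds because the range is a field containing all generators.\<close>

lemma aut_exists:
  assumes b: "(b ^ m)\<^sup>2 = 1" and \<delta>: "\<delta> \<in> {0, \<alpha>, - \<alpha>}"
  obtains \<sigma> where "is_aut \<sigma>" "\<sigma> x = emb (b ^ m) * x + emb \<delta>" "\<sigma> y = emb b * y"
proof -
  define \<epsilon> where "\<epsilon> = b ^ m"
  have \<epsilon>: "\<epsilon> = 1 \<or> \<epsilon> = - 1" using b by (simp add: \<epsilon>_def power2_eq_1_iff)
  have b0: "b \<noteq> 0" using b m_ge by (cases "b = 0") (auto simp: power_0_left)
  let ?u = "emb \<epsilon> * x + emb \<delta>" and ?v = "emb b * y"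
  have "\<delta> ^ 3 + \<delta> = \<delta> * (\<delta>\<^sup>2 + 1)" by (simp add: algebra_simps power2_eq_square power3_eq_cube)
  also have "\<dots> = 0" using \<delta> \<alpha>_sq by auto
  finally have "emb (\<delta> ^ 3 + \<delta>) = 0" by simp
  then have d: "emb \<delta> ^ 3 + emb \<delta> = 0" by simp
  have "?u * (?u\<^sup>2 + 1) = ?u ^ 3 + ?u"
    by (simp add: algebra_simps power2_eq_square power3_eq_cube)
  also have "\<dots> = emb \<epsilon> ^ 3 * x ^ 3 + emb \<epsilon> * x + (emb \<delta> ^ 3 + emb \<delta>)"
    unfolding cube_add by (simp add: power_mult_distrib)
  also have "emb \<epsilon> ^ 3 = emb \<epsilon>" using \<epsilon> by auto
  also have "emb \<epsilon> * x ^ 3 + emb \<epsilon> * x + (emb \<delta> ^ 3 + emb \<delta>) = emb \<epsilon> * y ^ m"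
    unfolding d x_cube by (simp add: algebra_simps)
  also have "\<dots> = ?v ^ m" by (simp add: power_mult_distrib \<epsilon>_def)
  finally have uv: "on_curve m ?u ?v" by (simp add: on_curve_def)
  have v: "?v \<notin> range emb"
  proof
    assume "?v \<in> range emb"
    then obtain c where "emb b * y = emb c" by auto
    then have "emb (inverse b) * (emb b * y) = emb (inverse b * c)" by simp
    then have "emb (inverse b * b) * y = emb (inverse b * c)" by (simp only: emb_mult mult.assoc)
    then have "y = emb (inverse b * c)" using b0 by simp
    then show False using y_notin by blast
  qed
  obtain \<sigma> where add: "\<And>a b. \<sigma> (a + b) = \<sigma> a + \<sigma> b" and mult: "\<And>a b. \<sigma> (a * b) = \<sigma> a * \<sigma> b"
    and const: "\<And>c. \<sigma> (emb c) = emb c" and sx: "\<sigma> x = ?u" and sy: "\<sigma> y = ?v"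
    using hom_exists[OF uv v] by blast
  have s0: "\<sigma> 0 = 0" and s1: "\<sigma> 1 = 1" using const[of 0] const[of 1] by simp_all
  have neg: "\<sigma> (- a) = - \<sigma> a" for a
    using add[of a "- a"] s0 by (simp add: eq_neg_iff_add_eq_0 add.commute)
  have nz: "\<sigma> a \<noteq> 0" if "a \<noteq> 0" for a
    using mult[of a "inverse a"] s1 that by auto
  have inverse: "\<sigma> (inverse a) = inverse (\<sigma> a)" for a
    using mult[of a "inverse a"] s1 s0 by (cases "a = 0") (auto simp: inverse_unique)
  have "inj \<sigma>"
  proof (rule injI)
    fix s t assume "\<sigma> s = \<sigma> t"
    then have "\<sigma> (s + - t) = 0" by (simp only: add neg) simp
    then show "s = t" using nz[of "s + - t"] by auto
  qed
  moreover have "range \<sigma> = UNIV"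
  proof (rule generation)
    show "range emb \<subseteq> range \<sigma>" using const by (metis image_subsetI rangeI)
    have "emb (inverse b * b) * y = y" using b0 by simp
    then have "\<sigma> (emb (inverse b) * y) = y"
      unfolding mult const sy by (simp only: emb_mult mult.assoc)
    then show "y \<in> range \<sigma>" by (metis rangeI)
    have "emb (\<epsilon> * \<epsilon>) * x = x" using \<epsilon> by auto
    then have "\<sigma> (emb \<epsilon> * (x + - emb \<delta>)) = x"
      unfolding mult add neg const sx by (simp add: mult_ac)
    then show "x \<in> range \<sigma>" by (metis rangeI)
    show "s \<in> range \<sigma> \<Longrightarrow> t \<in> range \<sigma> \<Longrightarrow> s + t \<in> range \<sigma>" for s t
      by (auto simp flip: add)
    show "s \<in> range \<sigma> \<Longrightarrow> t \<in> range \<sigma> \<Longrightarrow> s * t \<in> range \<sigma>" for s t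
      by (auto simp flip: mult)
    show "s \<in> range \<sigma> \<Longrightarrow> - s \<in> range \<sigma>" for s by (auto simp flip: neg)
    show "s \<in> range \<sigma> \<Longrightarrow> inverse s \<in> range \<sigma>" for s by (auto simp flip: inverse)
  qed
  ultimately have "is_aut \<sigma>" unfolding is_aut_def bij_def using add mult const by blast
  then show ?thesis using that sx sy unfolding \<epsilon>_def by blast
qed

lemma is_aut_inverse: "is_aut \<sigma> \<Longrightarrow> \<sigma> (inverse a) = inverse (\<sigma> a)"
  using is_aut_simps(2)[of \<sigma> a "inverse a"]
  by (cases "a = 0") (auto simp: is_aut_simps inverse_unique)

lemma aut_eqI:
  assumes \<sigma>: "is_aut \<sigma>" and \<tau>: "is_aut \<tau>" and "\<sigma> x = \<tau> x" "\<sigma> y = \<tau> y"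
  shows "\<sigma> = \<tau>"
proof -
  have "{w. \<sigma> w = \<tau> w} = UNIV"
    by (rule generation)
      (use assms in \<open>auto simp: is_aut_simps[OF \<sigma>] is_aut_simps[OF \<tau>] is_aut_inverse\<close>)
  then show ?thesis by auto
qed

lemma is_aut_id: "is_aut id"
  by (simp add: is_aut_def)

lemma is_aut_comp: "is_aut \<sigma> \<Longrightarrow> is_aut \<tau> \<Longrightarrow> is_aut (\<sigma> \<circ> \<tau>)"
  by (simp add: is_aut_def bij_comp)

end

section \<open>Roots of unity in a finite field and in its closure\<close>

lemma finite_field_power_card_diff_1:
  fixes c :: "'a::field"
  assumes "finite (UNIV :: 'a set)" "c \<noteq> 0"
  shows "c ^ (CARD('a) - 1) = 1"
proof -
  let ?U = "UNIV - {0 :: 'a}"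
  have "bij_betw ((*) c) ?U ?U"
    by (rule bij_betw_byWitness[of _ "\<lambda>z. z / c"]) (use assms(2) in auto)
  then have "\<Prod>?U = (\<Prod>z\<in>?U. c * z)" by (rule prod.reindex_bij_betw[symmetric])
  also have "\<dots> = c ^ (CARD('a) - 1) * \<Prod>?U"
    using assms(1) by (simp add: prod.distrib card_Diff_singleton)
  finally have "(c ^ (CARD('a) - 1) - 1) * \<Prod>?U = 0" by (simp add: algebra_simps)
  moreover have "\<Prod>?U \<noteq> 0" using assms(1) by simp
  ultimately show ?thesis by simp
qed

text \<open>Translation by 1 permutes the field, so the sum of all elements equals itself plus the
  number of elements. This is how the characteristic is found.\<close>

lemma finite_field_of_nat_card:
  assumes "finite (UNIV :: 'a::field set)"
  shows "(of_nat CARD('a) :: 'a) = 0"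
proof -
  have "bij ((+) (1 :: 'a))"
    by (rule bij_betw_byWitness[of _ "\<lambda>z. z - 1"]) auto
  then have "(\<Sum>z\<in>UNIV. z :: 'a) = (\<Sum>z\<in>UNIV. 1 + z)" by (rule sum.reindex_bij_betw[symmetric])
  also have "\<dots> = of_nat CARD('a) + (\<Sum>z\<in>UNIV. z)" by (simp add: sum.distrib)
  finally show ?thesis by simp
qed

lemma card_power_eq_1_le:
  assumes "0 < k"
  shows "finite {c :: 'a::field. c ^ k = 1}" "card {c :: 'a. c ^ k = 1} \<le> k"
proof -
  have p: "monom (1 :: 'a) k - 1 \<noteq> 0"
    using assms by (auto simp: poly_eq_iff coeff_monom dest!: spec[of _ k])
  have eq: "{c :: 'a. c ^ k = 1} = {c. poly (monom 1 k - 1) c = 0}"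
    by (simp add: poly_monom)
  show "finite {c :: 'a. c ^ k = 1}" unfolding eq by (rule poly_roots_finite[OF p])
  have "degree (monom (1 :: 'a) k - 1) \<le> k"
    by (intro degree_diff_le) (auto simp: degree_monom_le)
  then show "card {c :: 'a. c ^ k = 1} \<le> k"
    unfolding eq using card_poly_roots_bound[OF p] by (rule order_trans[rotated])
qed

text \<open>The \<open>k\<close>-th power sends the \<open>k * l\<close> nonzero elements to
  \<open>l\<close>-th roots of unity, of which there are at most \<open>l\<close>, and no fibre is
  larger than the kernel. Hence the kernel has at least \<open>k\<close> elements.\<close>

lemma card_roots_of_unity_finite_field:
  assumes fin: "finite (UNIV :: 'a::field set)" and dvd: "CARD('a) - 1 = k * l" and k: "0 < k" and l: "0 < l"
  shows "card {c :: 'a. c ^ k = 1} = k"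
proof -
  let ?F = "\<lambda>z. {c \<in> UNIV - {0 :: 'a}. c ^ k = z}"
  let ?T = "{z :: 'a. z ^ l = 1}"
  have F: "card (?F z) \<le> card {c :: 'a. c ^ k = 1}" for z
  proof (cases "?F z = {}")
    case False
    then obtain c0 where c0: "c0 \<noteq> 0" "c0 ^ k = z" by blast
    have "?F z \<subseteq> (*) c0 ` {c. c ^ k = 1}"
    proof
      fix c assume "c \<in> ?F z"
      then have "c = c0 * (c / c0)" "(c / c0) ^ k = 1" using c0 by (auto simp: power_divide)
      then show "c \<in> (*) c0 ` {c. c ^ k = 1}" by blast
    qed
    then have "card (?F z) \<le> card ((*) c0 ` {c. c ^ k = 1})"
      using card_power_eq_1_le(1)[OF k] by (intro card_mono) auto
    also have "\<dots> \<le> card {c :: 'a. c ^ k = 1}"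
      by (rule card_image_le[OF card_power_eq_1_le(1)[OF k]])
    finally show ?thesis .
  qed (simp only: card.empty le0)
  have "UNIV - {0 :: 'a} \<subseteq> (\<Union>z\<in>?T. ?F z)"
    using finite_field_power_card_diff_1[OF fin] unfolding dvd by (auto simp: power_mult)
  then have "card (UNIV - {0 :: 'a}) \<le> card (\<Union>z\<in>?T. ?F z)"
    using finite_subset[OF subset_UNIV fin] by (intro card_mono) auto
  also have "\<dots> \<le> (\<Sum>z\<in>?T. card (?F z))"
    by (rule card_UN_le[OF card_power_eq_1_le(1)[OF l]])
  also have "\<dots> \<le> (\<Sum>z\<in>?T. card {c :: 'a. c ^ k = 1})" by (intro sum_mono F)
  also have "\<dots> = card ?T * card {c :: 'a. c ^ k = 1}" by simp
  also have "\<dots> \<le> l * card {c :: 'a. c ^ k = 1}"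
    by (intro mult_right_mono card_power_eq_1_le(2)[OF l]) simp
  finally have "k * l \<le> l * card {c :: 'a. c ^ k = 1}"
    using fin dvd by (simp add: card_Diff_singleton)
  then have "k \<le> card {c :: 'a. c ^ k = 1}" using l by (simp add: mult.commute)
  then show ?thesis using card_power_eq_1_le(2)[OF k] by (rule antisym[rotated])
qed

text \<open>The closure has at most \<open>k\<close> such roots, and the base field already supplies
  that many. This reconciles automorphisms over the closed constants with the requirement in
  \<open>G1\<close> that \<open>a\<close> and \<open>b\<close> lie in the base field.\<close>

lemma root_of_unity_in_range_to_ac:
  fixes c :: "'a::field alg_closure"
  assumes "0 < k" "card {b :: 'a. b ^ k = 1} = k" "c ^ k = 1"
  shows "c \<in> range to_ac"
proof -
  have "inj_on to_ac {b :: 'a. b ^ k = 1}" by (rule inj_on_subset[OF inj_to_ac]) simp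
  then have "card (to_ac ` {b :: 'a. b ^ k = 1}) = k" using assms(2) by (simp only: card_image)
  moreover have sub: "to_ac ` {b :: 'a. b ^ k = 1} \<subseteq> {c :: 'a alg_closure. c ^ k = 1}"
    by (auto simp flip: to_ac_power)
  ultimately have "to_ac ` {b :: 'a. b ^ k = 1} = {c :: 'a alg_closure. c ^ k = 1}"
    using card_power_eq_1_le[OF assms(1), where 'a = "'a alg_closure"]
    by (intro card_seteq) auto
  then show ?thesis using assms(3) by blast
qed

section \<open>The automorphism group\<close>

lemma type_ring_simps [simp]:
  "carrier type_ring = UNIV" "a \<otimes>\<^bsub>type_ring\<^esub> b = a * b" "a \<oplus>\<^bsub>type_ring\<^esub> b = a + b"
  "\<one>\<^bsub>type_ring\<^esub> = 1" "\<zero>\<^bsub>type_ring\<^esub> = 0"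
  by (simp_all add: ring_of_type_algebra_def)

lemma type_ring_a_inv [simp]: "\<ominus>\<^bsub>type_ring\<^esub> a = - a"
proof -
  interpret field "type_ring :: 'a ring" by (rule field_from_type_algebra)
  show ?thesis using minus_equality[of "- a" a] by simp
qed

lemma type_ring_m_inv: "a \<noteq> 0 \<Longrightarrow> inv\<^bsub>type_ring\<^esub> a = inverse a"
proof -
  interpret field "type_ring :: 'a ring" by (rule field_from_type_algebra)
  assume "a \<noteq> 0"
  then show ?thesis using comm_inv_char[of a "inverse a"] by simp
qed

lemma generate_field_subset:
  fixes A S :: "'f::field set"
  assumes "A \<subseteq> S" "1 \<in> S"
    "\<And>a b. a \<in> S \<Longrightarrow> b \<in> S \<Longrightarrow> a + b \<in> S" "\<And>a b. a \<in> S \<Longrightarrow> b \<in> S \<Longrightarrow> a * b \<in> S"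
    "\<And>a. a \<in> S \<Longrightarrow> - a \<in> S" "\<And>a. a \<in> S \<Longrightarrow> inverse a \<in> S"
  shows "generate_field type_ring A \<subseteq> S"
proof
  show "w \<in> S" if "w \<in> generate_field type_ring A" for w
    using that by induction (use assms in \<open>auto simp: type_ring_m_inv\<close>)
qed

text \<open>Every element of the closure is algebraic over the base field, so transcendence of
  \<open>x\<close> over the base field keeps it out of the constants.\<close>

lemma F1_const_ext_imp_curve_field:
  fixes emb :: "'a::field alg_closure \<Rightarrow> 'f::field"
  assumes F1: "F1_const_ext m emb x y"
    and "(3 :: 'a) = 0" "m mod 3 = 2" "m \<ge> 5" "\<alpha>\<^sup>2 + 1 = (0 :: 'a)"
  shows "curve_field emb x y m (to_ac \<alpha>)"
proof -
  interpret F1_const_ext m emb x y by (rule F1)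
  have add: "emb (a + b) = emb a + emb b" and mult: "emb (a * b) = emb a * emb b"
    and one: "emb 1 = 1" for a b
    using emb_hom by (auto simp: ring_hom_def)
  have zero: "emb 0 = 0" using add[of 0 0] unfolding add_0_right by (metis add_cancel_left_right)
  show ?thesis
  proof
    show "emb 1 = 1" "emb (a + b) = emb a + emb b" "emb (a * b) = emb a * emb b" for a b
      by (rule one add mult)+
    have "to_ac (3 :: 'a) = 0" using assms(2) by simp
    then show "(3 :: 'a alg_closure) = 0" by simp
    have "to_ac (\<alpha>\<^sup>2 + 1) = 0" using assms(5) by simp
    then show "(to_ac \<alpha>)\<^sup>2 + 1 = 0" by simp
    show "on_curve m x y" using curve by (simp add: on_curve_def)
    show "x \<notin> range emb"
    proof
      assume "x \<in> range emb"
      then obtain c where c: "x = emb c" by auto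
      obtain p :: "'a poly" where p: "p \<noteq> 0" "poly (map_poly to_ac p) c = 0"
        by (rule alg_closure_algebraic)
      have "poly (map_poly (\<lambda>c. emb (to_ac c)) p) (emb c) = emb (poly (map_poly to_ac p) c)" for p
        by (induction p) (simp_all add: map_poly_pCons add mult zero)
      then show False using x_transcendental[OF p(1)] p(2) c zero by simp
    qed
    fix S assume S: "range emb \<subseteq> S" "x \<in> S" "y \<in> S" 
      "\<And>a b. a \<in> S \<Longrightarrow> b \<in> S \<Longrightarrow> a + b \<in> S" "\<And>a b. a \<in> S \<Longrightarrow> b \<in> S \<Longrightarrow> a * b \<in> S"
      "\<And>a. a \<in> S \<Longrightarrow> - a \<in> S" "\<And>a. a \<in> S \<Longrightarrow> inverse a \<in> S"
    have 1: "1 \<in> S" using S(1) one by (metis rangeI subsetD)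
    have "function_field emb x y \<subseteq> S"
      unfolding function_field_def by (rule generate_field_subset) (use S 1 in auto)
    then have "generate_field type_ring (range emb \<union> function_field emb x y) \<subseteq> S"
      by (intro generate_field_subset) (use S 1 in auto)
    then show "S = UNIV" using compositum by auto
  qed (use assms in auto)
qed

text \<open>Here \<open>2 * m - 1\<close> is \<open>q\<close>.\<close>

locale curve_field_over = curve_field emb x y m "to_ac \<alpha>"
  for emb :: "'a::field alg_closure \<Rightarrow> 'f::field" and x y :: 'f and m :: nat and \<alpha> :: 'a +
  assumes card_field: "CARD('a) = (2 * m - 1)\<^sup>2"
begin

abbreviation "G \<equiv> Aut_group emb"

lemma carrier_G: "\<sigma> \<in> carrier G \<longleftrightarrow> is_aut \<sigma>"
proof
  assume "\<sigma> \<in> carrier G"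
  then show "is_aut \<sigma>" by (auto simp: Aut_group_def ring_iso_def ring_hom_def is_aut_def)
next
  assume "is_aut \<sigma>"
  then show "\<sigma> \<in> carrier G"
    using is_aut_simps(5) by (auto simp: Aut_group_def ring_iso_def ring_hom_def is_aut_def)
qed

lemma G_simps [simp]: "\<sigma> \<otimes>\<^bsub>G\<^esub> \<tau> = \<sigma> \<circ> \<tau>" "\<one>\<^bsub>G\<^esub> = id"
  by (simp_all add: Aut_group_def)

lemma group_G: "group G"
proof (rule groupI)
  fix \<sigma> assume "\<sigma> \<in> carrier G"
  then have \<sigma>: "is_aut \<sigma>" by (simp add: carrier_G)
  have "inv_into UNIV \<sigma> \<circ> \<sigma> = id" using is_aut_simps(12)[OF \<sigma>] by auto
  then show "\<exists>\<tau>\<in>carrier G. \<tau> \<otimes>\<^bsub>G\<^esub> \<sigma> = \<one>\<^bsub>G\<^esub>" using is_aut_inv[OF \<sigma>] by (auto simp: carrier_G)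
qed (simp_all add: carrier_G is_aut_comp is_aut_id comp_assoc)

sublocale group G by (rule group_G)

lemma y_nz: "y \<noteq> 0"
  using y_notin by (metis emb_0 rangeI)

lemma finite_field: "finite (UNIV :: 'a set)"
proof -
  have "CARD('a) > 0" using card_field m_ge by simp
  then show ?thesis by (rule card_ge_0_finite)
qed

lemma card_roots_of_unity: "card {b :: 'a. b ^ (2 * m) = 1} = 2 * m"
proof -
  \<comment> \<open>This is \<open>q^2 - 1 = (q + 1) (q - 1)\<close>.\<close>
  have "CARD('a) - 1 = 2 * m * (2 * m - 2)"
    using m_ge by (cases m) (simp_all add: card_field power2_eq_square)
  then show ?thesis
    using m_ge by (intro card_roots_of_unity_finite_field[OF finite_field]) auto
qed

lemma root_of_unity_to_ac:
  assumes "(b ^ m)\<^sup>2 = 1"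
  obtains b' :: 'a where "b = to_ac b'" "(b' ^ m)\<^sup>2 = 1"
proof -
  have b: "b ^ (2 * m) = 1" using assms by (metis mult.commute power_mult)
  have "b \<in> range to_ac"
    by (rule root_of_unity_in_range_to_ac[OF _ card_roots_of_unity b]) (use m_ge in simp)
  then obtain b' where b': "b = to_ac b'" by auto
  then have "to_ac ((b' ^ m)\<^sup>2) = 1" using assms by simp
  then have "(b' ^ m)\<^sup>2 = 1" by (simp only: to_ac_eq_1_iff)
  then show ?thesis using that b' by simp
qed

lemma \<alpha>_neq_minus: "to_ac \<alpha> \<noteq> - to_ac \<alpha>"
proof
  assume "to_ac \<alpha> = - to_ac \<alpha>"
  then have "2 * to_ac \<alpha> = 0" unfolding mult_2 by (metis add.right_inverse)
  then show False unfolding two_eq using \<alpha>_nz by simp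
qed

text \<open>This is the Galois group over \<open>K(y)\<close>; it turns out to consist of the powers
  of \<open>\<gamma>\<close>.\<close>

definition deck_group :: "('f \<Rightarrow> 'f) set" where
  "deck_group = {\<sigma>. is_aut \<sigma> \<and> \<sigma> y = y}"

lemma translation_form:
  assumes "\<sigma> \<in> deck_group"
  obtains \<delta> where "\<delta> \<in> {0, to_ac \<alpha>, - to_ac \<alpha>}" "\<sigma> x = x + emb \<delta>"
proof -
  have \<sigma>: "is_aut \<sigma>" "\<sigma> y = y" using assms by (auto simp: deck_group_def)
  obtain b \<delta> where b: "\<delta> \<in> {0, to_ac \<alpha>, - to_ac \<alpha>}" "\<sigma> x = emb (b ^ m) * x + emb \<delta>" "\<sigma> y = emb b * y"
    using aut_form[OF \<sigma>(1)] by metis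
  have "emb b = emb 1" using b(3) \<sigma>(2) y_nz by simp
  then have "b = 1" by (simp only: emb_eq_iff)
  then show ?thesis using that b by simp
qed

lemma translation_exists:
  assumes "\<delta> \<in> {0, to_ac \<alpha>, - to_ac \<alpha>}"
  obtains \<sigma> where "\<sigma> \<in> deck_group" "\<sigma> x = x + emb \<delta>"
proof -
  obtain \<sigma> where "is_aut \<sigma>" "\<sigma> x = emb (1 ^ m) * x + emb \<delta>" "\<sigma> y = emb 1 * y"
    using aut_exists[of 1 \<delta>] assms by auto
  then show ?thesis using that by (simp add: deck_group_def)
qed

lemma translation_comp:
  assumes "\<sigma> \<in> deck_group" "\<sigma> x = x + emb \<delta>" "\<tau> \<in> deck_group" "\<tau> x = x + emb \<delta>'"
  shows "\<sigma> \<circ> \<tau> \<in> deck_group" "(\<sigma> \<circ> \<tau>) x = x + emb (\<delta> + \<delta>')"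
  using assms by (auto simp: deck_group_def is_aut_comp is_aut_simps)

lemma subgroup_deck_group: "subgroup deck_group G"
proof (rule subgroupI)
  show "deck_group \<subseteq> carrier G" by (auto simp: deck_group_def carrier_G)
  have "id \<in> deck_group" by (simp add: deck_group_def is_aut_id)
  then show "deck_group \<noteq> {}" by blast
next
  fix \<sigma> assume "\<sigma> \<in> deck_group"
  then have \<sigma>: "\<sigma> \<in> carrier G" "\<sigma> y = y" by (auto simp: deck_group_def carrier_G)
  have "(inv\<^bsub>G\<^esub> \<sigma> \<circ> \<sigma>) y = id y" using l_inv[OF \<sigma>(1)] by simp
  then have "(inv\<^bsub>G\<^esub> \<sigma>) y = y" using \<sigma>(2) by simp
  then show "inv\<^bsub>G\<^esub> \<sigma> \<in> deck_group" using inv_closed[OF \<sigma>(1)] by (simp add: deck_group_def carrier_G)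
next
  fix \<sigma> \<tau> assume "\<sigma> \<in> deck_group" "\<tau> \<in> deck_group"
  then show "\<sigma> \<otimes>\<^bsub>G\<^esub> \<tau> \<in> deck_group" by (simp add: deck_group_def is_aut_comp)
qed

text \<open>Every automorphism multiplies \<open>y\<close> by a constant, and constant multiples of
  \<open>y\<close> are fixed by the deck group.\<close>

lemma normal_deck_group: "deck_group \<lhd> G"
proof (rule normal_invI[OF subgroup_deck_group])
  fix \<sigma> \<tau> assume \<sigma>: "\<sigma> \<in> carrier G" and \<tau>: "\<tau> \<in> deck_group"
  have i: "is_aut (inv\<^bsub>G\<^esub> \<sigma>)" using inv_closed[OF \<sigma>] by (simp add: carrier_G)
  obtain b where b: "(inv\<^bsub>G\<^esub> \<sigma>) y = emb b * y" using aut_form[OF i] by metis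
  have t: "is_aut \<tau>" "\<tau> y = y" using \<tau> by (auto simp: deck_group_def)
  have "\<tau> ((inv\<^bsub>G\<^esub> \<sigma>) y) = (inv\<^bsub>G\<^esub> \<sigma>) y" unfolding b by (simp add: is_aut_simps t)
  moreover have "(\<sigma> \<circ> inv\<^bsub>G\<^esub> \<sigma>) y = id y" using r_inv[OF \<sigma>] by simp
  ultimately have "(\<sigma> \<circ> \<tau> \<circ> inv\<^bsub>G\<^esub> \<sigma>) y = y" by simp
  moreover have "is_aut (\<sigma> \<circ> \<tau> \<circ> inv\<^bsub>G\<^esub> \<sigma>)" using \<sigma> t i by (simp add: is_aut_comp carrier_G)
  ultimately show "\<sigma> \<otimes>\<^bsub>G\<^esub> \<tau> \<otimes>\<^bsub>G\<^esub> inv\<^bsub>G\<^esub> \<sigma> \<in> deck_group" by (simp add: deck_group_def)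
qed

lemma deck_group_eq:
  assumes \<gamma>: "\<gamma> \<in> deck_group" "\<gamma> x = x + emb (to_ac \<alpha>)"
  shows "deck_group = {id, \<gamma>, \<gamma> \<circ> \<gamma>}" "card deck_group = 3"
proof -
  have id: "id \<in> deck_group" "id x = x + emb 0" by (simp_all add: deck_group_def is_aut_id)
  have \<alpha>2: "to_ac \<alpha> + to_ac \<alpha> = - to_ac \<alpha>"
    using char_3 by (metis add.commute add_eq_0_iff mult_2 mult_minus1 two_eq(1))
  have \<gamma>2: "\<gamma> \<circ> \<gamma> \<in> deck_group" "(\<gamma> \<circ> \<gamma>) x = x + emb (- to_ac \<alpha>)"
    using translation_comp[OF \<gamma> \<gamma>] unfolding \<alpha>2 by auto
  have eqI: "\<sigma> = \<tau>" if "\<sigma> \<in> deck_group" "\<tau> \<in> deck_group" "\<sigma> x = \<tau> x" for \<sigma> \<tau>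
    using that by (intro aut_eqI) (auto simp: deck_group_def)
  have "\<sigma> \<in> {id, \<gamma>, \<gamma> \<circ> \<gamma>}" if \<sigma>: "\<sigma> \<in> deck_group" for \<sigma>
  proof -
    obtain \<delta> where "\<delta> \<in> {0, to_ac \<alpha>, - to_ac \<alpha>}" "\<sigma> x = x + emb \<delta>"
      by (rule translation_form[OF \<sigma>])
    then have "\<sigma> x = id x \<or> \<sigma> x = \<gamma> x \<or> \<sigma> x = (\<gamma> \<circ> \<gamma>) x" using id \<gamma> \<gamma>2 by auto
    then show ?thesis using eqI[OF \<sigma>] id(1) \<gamma>(1) \<gamma>2(1) by blast
  qed
  then show eq: "deck_group = {id, \<gamma>, \<gamma> \<circ> \<gamma>}" using id(1) \<gamma>(1) \<gamma>2(1) by blast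
  have "emb (to_ac \<alpha>) \<noteq> emb (- to_ac \<alpha>)" using \<alpha>_neq_minus by (simp only: emb_eq_iff not_False_eq_True)
  then have "id x \<noteq> \<gamma> x" "id x \<noteq> (\<gamma> \<circ> \<gamma>) x" "\<gamma> x \<noteq> (\<gamma> \<circ> \<gamma>) x"
    unfolding id \<gamma> \<gamma>2 using \<alpha>_nz by (simp_all del: emb_minus)
  then have "id \<noteq> \<gamma>" "id \<noteq> \<gamma> \<circ> \<gamma>" "\<gamma> \<noteq> \<gamma> \<circ> \<gamma>" by metis+
  then show "card deck_group = 3" unfolding eq by simp
qed

lemma generate_translation:
  assumes \<gamma>: "\<gamma> \<in> deck_group" "\<gamma> x = x + emb (to_ac \<alpha>)"
  shows "generate G {\<gamma>} = deck_group"
proof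
  show "generate G {\<gamma>} \<subseteq> deck_group"
    by (rule generate_subgroup_incl[OF _ subgroup_deck_group]) (use \<gamma> in simp)
  have "\<gamma> \<in> generate G {\<gamma>}" by (simp add: generate.incl)
  then have "\<gamma> \<circ> \<gamma> \<in> generate G {\<gamma>}" using generate.eng[of \<gamma> G "{\<gamma>}" \<gamma>] by simp
  moreover have "id \<in> generate G {\<gamma>}" using generate.one[of G "{\<gamma>}"] by simp
  ultimately show "deck_group \<subseteq> generate G {\<gamma>}"
    unfolding deck_group_eq(1)[OF \<gamma>] using \<open>\<gamma> \<in> generate G {\<gamma>}\<close> by blast
qed

lemma G1_iff:
  "\<sigma> \<in> G1 m emb x y \<longleftrightarrow> is_aut \<sigma> \<and> (\<exists>b :: 'a. (b ^ m)\<^sup>2 = 1 \<and>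
     \<sigma> x = emb (to_ac b ^ m) * x \<and> \<sigma> y = emb (to_ac b) * y)"
  by (simp only: G1_def carrier_G mem_Collect_eq) (metis to_ac_power)

lemma subgroup_G1: "subgroup (G1 m emb x y) G"
proof (rule subgroupI)
  show "G1 m emb x y \<subseteq> carrier G" by (auto simp: G1_iff carrier_G)
  have "id \<in> G1 m emb x y" unfolding G1_iff by (auto simp: is_aut_id intro!: exI[of _ 1])
  then show "G1 m emb x y \<noteq> {}" by blast
next
  fix \<sigma> assume "\<sigma> \<in> G1 m emb x y"
  then obtain b :: 'a where \<sigma>: "is_aut \<sigma>" and b: "(b ^ m)\<^sup>2 = 1" "\<sigma> x = emb (to_ac b ^ m) * x" "\<sigma> y = emb (to_ac b) * y"
    unfolding G1_iff by blast
  have \<sigma>G: "\<sigma> \<in> carrier G" using \<sigma> by (simp add: carrier_G)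
  have i: "is_aut (inv\<^bsub>G\<^esub> \<sigma>)" using inv_closed[OF \<sigma>G] by (simp add: carrier_G)
  have b0: "b \<noteq> 0" using b(1) m_ge by (cases "b = 0") (auto simp: power_0_left)
  have li: "(inv\<^bsub>G\<^esub> \<sigma>) (\<sigma> w) = w" for w using fun_cong[OF l_inv[OF \<sigma>G], of w] by simp
  have cancel: "(inv\<^bsub>G\<^esub> \<sigma>) w = emb (to_ac (inverse c)) * w"
    if "\<sigma> w = emb (to_ac c) * w" "c \<noteq> 0" for w c
  proof -
    have "w = emb (to_ac c) * (inv\<^bsub>G\<^esub> \<sigma>) w"
      using li[of w] unfolding that(1) by (simp add: is_aut_simps[OF i])
    then have "emb (to_ac (inverse c)) * w = emb (to_ac (inverse c) * to_ac c) * (inv\<^bsub>G\<^esub> \<sigma>) w"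
      by (metis emb_mult mult.assoc)
    also have "to_ac (inverse c) * to_ac c = 1" using that(2) by simp
    finally show ?thesis by simp
  qed
  have "(inv\<^bsub>G\<^esub> \<sigma>) x = emb (to_ac (inverse (b ^ m))) * x" "(inv\<^bsub>G\<^esub> \<sigma>) y = emb (to_ac (inverse b)) * y"
    using b b0 by (intro cancel; simp)+
  moreover have "to_ac (inverse (b ^ m)) = to_ac (inverse b) ^ m" by (simp add: power_inverse)
  moreover have "(inverse b ^ m)\<^sup>2 = 1" using b(1) by (simp add: power_inverse)
  ultimately show "inv\<^bsub>G\<^esub> \<sigma> \<in> G1 m emb x y"
    unfolding G1_iff using i by metis
next
  fix \<sigma> \<tau> assume "\<sigma> \<in> G1 m emb x y" "\<tau> \<in> G1 m emb x y"
  then obtain b c :: 'a where \<sigma>: "is_aut \<sigma>" "(b ^ m)\<^sup>2 = 1" "\<sigma> x = emb (to_ac b ^ m) * x" "\<sigma> y = emb (to_ac b) * y"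
    and \<tau>: "is_aut \<tau>" "(c ^ m)\<^sup>2 = 1" "\<tau> x = emb (to_ac c ^ m) * x" "\<tau> y = emb (to_ac c) * y"
    unfolding G1_iff by blast
  have "((b * c) ^ m)\<^sup>2 = 1" using \<sigma>(2) \<tau>(2) by (simp add: power_mult_distrib)
  moreover have "(\<sigma> \<circ> \<tau>) x = emb (to_ac (b * c) ^ m) * x" "(\<sigma> \<circ> \<tau>) y = emb (to_ac (b * c)) * y"
    using \<sigma> \<tau> by (simp_all add: is_aut_simps power_mult_distrib mult_ac)
  ultimately show "\<sigma> \<otimes>\<^bsub>G\<^esub> \<tau> \<in> G1 m emb x y"
    unfolding G1_iff G_simps using is_aut_comp[OF \<sigma>(1) \<tau>(1)] by blast
qed

lemma deck_group_inter_G1: "deck_group \<inter> G1 m emb x y = {id}"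
proof -
  have "\<sigma> = id" if in_both: "\<sigma> \<in> deck_group" "\<sigma> \<in> G1 m emb x y" for \<sigma>
  proof -
    obtain b :: 'a where \<sigma>: "is_aut \<sigma>" "\<sigma> y = y" "\<sigma> x = emb (to_ac b ^ m) * x" "\<sigma> y = emb (to_ac b) * y"
      using in_both unfolding G1_iff deck_group_def by blast
    have "emb (to_ac b) = emb 1" using \<sigma>(2,4) y_nz by simp
    then have "to_ac b = 1" by (simp only: emb_eq_iff)
    then show ?thesis using \<sigma> by (intro aut_eqI) (simp_all add: is_aut_id)
  qed
  moreover have "id \<in> deck_group" "id \<in> G1 m emb x y"
    using subgroup.one_closed[OF subgroup_deck_group] subgroup.one_closed[OF subgroup_G1] by simp_all
  ultimately show ?thesis by blast
qed

lemma deck_group_mult_G1: "deck_group <#>\<^bsub>G\<^esub> G1 m emb x y = carrier G"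
proof
  show "deck_group <#>\<^bsub>G\<^esub> G1 m emb x y \<subseteq> carrier G"
    using set_mult_closed subgroup.subset[OF subgroup_deck_group] subgroup.subset[OF subgroup_G1] by blast
  show "carrier G \<subseteq> deck_group <#>\<^bsub>G\<^esub> G1 m emb x y"
  proof
    fix \<sigma> assume "\<sigma> \<in> carrier G"
    then have \<sigma>: "is_aut \<sigma>" by (simp add: carrier_G)
    obtain b \<delta> where b: "(b ^ m)\<^sup>2 = 1" and \<delta>: "\<delta> \<in> {0, to_ac \<alpha>, - to_ac \<alpha>}"
      and s: "\<sigma> x = emb (b ^ m) * x + emb \<delta>" "\<sigma> y = emb b * y"
      using aut_form[OF \<sigma>] by metis
    obtain b' where b': "b = to_ac b'" "(b' ^ m)\<^sup>2 = 1" by (rule root_of_unity_to_ac[OF b])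
    have "b ^ m = 1 \<or> b ^ m = - 1" using b by (simp add: power2_eq_1_iff)
    \<comment> \<open>The translation is by \<open>b^m \<delta>\<close> because the composite sends
      \<open>x\<close> to \<open>b^m (x + b^m \<delta>)\<close>, and \<open>b^(2m) = 1\<close> turns
      this into \<open>b^m x + \<delta>\<close>.\<close>
    then have \<delta>': "b ^ m * \<delta> \<in> {0, to_ac \<alpha>, - to_ac \<alpha>}" using \<delta> by auto
    obtain \<tau> where \<tau>: "\<tau> \<in> deck_group" "\<tau> x = x + emb (b ^ m * \<delta>)"
      by (rule translation_exists[OF \<delta>'])
    obtain h where h: "is_aut h" "h x = emb (b ^ m) * x" "h y = emb b * y"
      using aut_exists[OF b, of 0] by auto
    have "b ^ m * (b ^ m * \<delta>) = (b ^ m)\<^sup>2 * \<delta>" by (simp add: power2_eq_square)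
    then have bb: "b ^ m * (b ^ m * \<delta>) = \<delta>" using b by simp
    have t: "is_aut \<tau>" "\<tau> y = y" using \<tau> by (auto simp: deck_group_def)
    have "(\<tau> \<circ> h) x = emb (b ^ m) * x + emb (b ^ m * (b ^ m * \<delta>))"
      using \<tau> t h by (simp add: is_aut_simps distrib_left)
    then have "(\<tau> \<circ> h) x = \<sigma> x" unfolding bb s .
    moreover have "(\<tau> \<circ> h) y = \<sigma> y" using t h s by (simp add: is_aut_simps)
    ultimately have "\<sigma> = \<tau> \<circ> h" using \<sigma> t h by (intro aut_eqI) (simp_all add: is_aut_comp)
    moreover have "h \<in> G1 m emb x y" unfolding G1_iff using h b' by auto
    ultimately show "\<sigma> \<in> deck_group <#>\<^bsub>G\<^esub> G1 m emb x y"
      using \<tau>(1) unfolding set_mult_def by auto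
  qed
qed

text \<open>Automorphisms are determined by the images of \<open>x\<close> and \<open>y\<close>,
  hence counted by pairs of a \<open>2m\<close>-th root of unity \<open>b\<close> and one of three
  translations \<open>\<delta>\<close>, all in the base field.\<close>

lemma card_carrier: "card (carrier G) = 6 * m"
proof -
  let ?B = "{b :: 'a. b ^ (2 * m) = 1}" and ?D = "{0, \<alpha>, - \<alpha>}"
  let ?f = "\<lambda>\<sigma> :: 'f \<Rightarrow> 'f. (\<sigma> x, \<sigma> y)"
  let ?g = "\<lambda>(b, \<delta>). (emb (to_ac b ^ m) * x + emb (to_ac \<delta>), emb (to_ac b) * y)"
  have B: "b ^ (2 * m) = 1 \<longleftrightarrow> (b ^ m)\<^sup>2 = 1" for b :: 'a
    by (simp add: power_mult[symmetric] mult.commute)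
  have "inj_on ?f (carrier G)"
    by (rule inj_onI) (auto simp: carrier_G intro: aut_eqI)
  then have "card (carrier G) = card (?f ` carrier G)" by (simp add: card_image)
  also have "?f ` carrier G = ?g ` (?B \<times> ?D)"
  proof
    show "?f ` carrier G \<subseteq> ?g ` (?B \<times> ?D)"
    proof
      fix p assume "p \<in> ?f ` carrier G"
      then obtain \<sigma> where \<sigma>: "is_aut \<sigma>" and p: "p = (\<sigma> x, \<sigma> y)" by (auto simp: carrier_G)
      obtain b \<delta> where b: "(b ^ m)\<^sup>2 = 1" and \<delta>: "\<delta> \<in> {0, to_ac \<alpha>, - to_ac \<alpha>}"
        and s: "\<sigma> x = emb (b ^ m) * x + emb \<delta>" "\<sigma> y = emb b * y"
        using aut_form[OF \<sigma>] by metis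
      obtain b' where b': "b = to_ac b'" "(b' ^ m)\<^sup>2 = 1" by (rule root_of_unity_to_ac[OF b])
      have "\<delta> \<in> to_ac ` ?D" using \<delta> by auto
      then obtain \<delta>' where \<delta>': "\<delta>' \<in> ?D" "\<delta> = to_ac \<delta>'" by blast
      have "p = ?g (b', \<delta>')" unfolding p s b' \<delta>' by simp
      moreover have "(b', \<delta>') \<in> ?B \<times> ?D" using b'(2) \<delta>'(1) B by auto
      ultimately show "p \<in> ?g ` (?B \<times> ?D)" by (rule image_eqI)
    qed
    show "?g ` (?B \<times> ?D) \<subseteq> ?f ` carrier G"
    proof
      fix p assume "p \<in> ?g ` (?B \<times> ?D)"
      then obtain b \<delta> where b: "(b ^ m)\<^sup>2 = 1" "\<delta> \<in> ?D" and
        p: "p = (emb (to_ac b ^ m) * x + emb (to_ac \<delta>), emb (to_ac b) * y)"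
        using B by auto
      have "to_ac ((b ^ m)\<^sup>2) = 1" using b(1) by (simp only: to_ac_1)
      then have "(to_ac b ^ m)\<^sup>2 = 1" by simp
      moreover have "to_ac \<delta> \<in> {0, to_ac \<alpha>, - to_ac \<alpha>}" using b(2) by auto
      ultimately obtain \<sigma> where "is_aut \<sigma>" "\<sigma> x = emb (to_ac b ^ m) * x + emb (to_ac \<delta>)" "\<sigma> y = emb (to_ac b) * y"
        by (rule aut_exists)
      then show "p \<in> ?f ` carrier G" unfolding p by (intro image_eqI[of _ _ \<sigma>]) (simp_all add: carrier_G)
    qed
  qed
  also have "card (?g ` (?B \<times> ?D)) = card (?B \<times> ?D)"
  proof (rule card_image, rule inj_onI)
    fix p p' assume eq: "?g p = ?g p'"
    obtain b \<delta> b' \<delta>' where p: "p = (b, \<delta>)" "p' = (b', \<delta>')" by (cases p; cases p') auto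
    have "emb (to_ac b) = emb (to_ac b')" using eq y_nz by (simp add: p)
    then have "b = b'" by (simp only: emb_eq_iff to_ac_eq_iff)
    with eq show "p = p'" by (simp add: p)
  qed
  also have "\<dots> = 2 * m * 3"
  proof -
    have "\<alpha> \<noteq> 0" using \<alpha>_nz by simp
    moreover have "\<alpha> \<noteq> - \<alpha>"
      using \<alpha>_neq_minus by (metis to_ac_minus)
    ultimately have "card ?D = 3" by simp
    then show ?thesis by (simp only: card_cartesian_product card_roots_of_unity)
  qed
  finally show ?thesis by simp
qed

end

theorem corollary4p3:
  fixes n q m :: nat
    and \<alpha> :: "'a::field"
    and emb :: "'a alg_closure \<Rightarrow> 'f::field"
    and x y :: 'f
  assumes "n > 1"
    and "q = 3 ^ n"
    and "m = (q + 1) div 2"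
    and "CARD('a) = q ^ 2"
    and "\<alpha> ^ 2 + 1 = 0"
    and "F1_const_ext m emb x y"
  shows "\<exists>\<gamma> \<in> carrier (Aut_group emb).
           \<gamma> x = x + emb (to_ac \<alpha>) \<and> \<gamma> y = y \<and>
           card (generate (Aut_group emb) {\<gamma>}) = 3 \<and>
           internal_semidirect (Aut_group emb) (generate (Aut_group emb) {\<gamma>}) (G1 m emb x y) \<and>
           Coset.order (Aut_group emb) = 3 * (q + 1)"
proof -
  define k where "k = (3 :: nat) ^ (n - 2)"
  \<comment> \<open>Since \<open>n > 1\<close>, 9 divides \<open>q\<close>, and
    \<open>2m = q + 1\<close> gives both the residue of \<open>m\<close> modulo 3 and
    \<open>m \<ge> 5\<close>.\<close>
  have "n = Suc (Suc (n - 2))" using assms(1) by simp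
  then have "q = 3 ^ Suc (Suc (n - 2))" unfolding assms(2) by (rule arg_cong)
  then have q: "q = 9 * k" by (simp add: k_def)
  have k: "odd k" "k \<ge> 1" by (simp_all add: k_def)
  have m: "2 * m = q + 1" "m mod 3 = 2" "m \<ge> 5" using assms(3) q k by presburger+
  have fin: "finite (UNIV :: 'a set)" using assms(4) q k by (intro card_ge_0_finite) simp
  have "(of_nat CARD('a) :: 'a) = 0" by (rule finite_field_of_nat_card[OF fin])
  then have "(3 :: 'a) ^ (n * 2) = 0" unfolding assms(4,2) by (simp add: power_mult)
  then have char_3: "(3 :: 'a) = 0" by simp
  interpret curve_field emb x y m "to_ac \<alpha>"
    using F1_const_ext_imp_curve_field[OF assms(6) char_3 m(2,3) assms(5)] .
  interpret curve_field_over emb x y m \<alpha>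
    by unfold_locales (use assms(4) m(1) in simp)
  obtain \<gamma> where \<gamma>: "\<gamma> \<in> deck_group" "\<gamma> x = x + emb (to_ac \<alpha>)"
    using translation_exists[of "to_ac \<alpha>"] by auto
  show ?thesis
  proof (intro bexI conjI)
    show "\<gamma> \<in> carrier (Aut_group emb)" "\<gamma> y = y" using \<gamma> by (auto simp: deck_group_def carrier_G)
    show "\<gamma> x = x + emb (to_ac \<alpha>)" by (rule \<gamma>)
    show "card (generate (Aut_group emb) {\<gamma>}) = 3"
      unfolding generate_translation[OF \<gamma>] by (rule deck_group_eq(2)[OF \<gamma>])
    show "internal_semidirect (Aut_group emb) (generate (Aut_group emb) {\<gamma>}) (G1 m emb x y)"
      unfolding internal_semidirect_def generate_translation[OF \<gamma>]
      using group_G normal_deck_group subgroup_G1 deck_group_inter_G1 deck_group_mult_G1 by simp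
    show "Coset.order (Aut_group emb) = 3 * (q + 1)"
      using card_carrier m(1) by (simp add: Coset.order_def)
  qed
qed

end
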